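(* Let $\xi:[1,n]\to\mathbb Z$ be a height function. For $1\le i\le j\le n$, in the cluster algebra $\mathcal A(\mathbf x,Q_\xi)$ we have $$x[\alpha_{i,j}]=\sum_{\boldsymbol\epsilon\in\Gamma_{i,j}}f_{i,j}^{\boldsymbol\epsilon}\,m_{i,j}^{\boldsymbol\epsilon},$$ where, for $\boldsymbol\epsilon=(\epsilon_i,\dots,\epsilon_{j+1})$ and $p_{i,j}(\boldsymbol\epsilon)=(\epsilon_i',\dots,\epsilon_{j+1}')$, $$m_{i,j}^{\boldsymbol\epsilon}=x_{i-1}^{1-\epsilon_i}x_i^{\epsilon_i'}\cdots x_j^{\epsilon_j'}x_{j+1}^{\epsilon_{j+1}'},\qquad f_{i,j}^{\boldsymbol\epsilon}=f_i^{\epsilon_i}\cdots f_j^{\epsilon_j}f_{j+1}^{(1-d_j)\epsilon_{j+1}}.$$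
   Context: Combinatorics. Let $n\ge2$ and $[i,j]=\{i,i+1,\dots,j\}$. A height function is a map $\xi:[1,n]\to\mathbb Z$ with $|\xi(i)-\xi(i-1)|=1$ for $2\le i\le n$; it is extended to $[0,n+1]$ by $\xi(0)=\xi(2)$, $\xi(n+1)=\xi(n-1)$. For $i\in[1,n-2]$ let $i_\diamond\in[i,n]$ be minimal such that $\xi(i_\diamond)=\xi(i_\diamond+2)$; set $(n-1)_\diamond=n-1$ and $n_\diamond=n$. Let $d_j=\delta_{j,j_\diamond}$ for $1\le j\le n$ (Kronecker delta). Quiver. $Q_\xi$ is the quiver with vertices $1,\dots,n,1',\dots,n'$, where $1',\dots,n'$ are frozen, with no edges between primed vertices. For $1\le j\le n-1$ with $\xi(j)=\xi(j+1)+1$ the edges at $j$ are: $j\to j-1$ (if $j\ge2$); $j'\to j$; if $j=j_\diamond$, $j\to j+1$; if $j\ne j_\diamond$, $j+1\to j$ and $j\to(j+1)'$. If $\xi(j)=\xi(j+1)-1$ all these edges have reversed orientation. At $n$ the edges are $(n-1)\to n\to n'$ if $\xi(n-1)=\xi(n)+1$ and reversed otherwise. Ignoring the frozen vertices, $j$ is a sink or source of $Q_\xi$ iff $j=1$ or $j=j_\diamond$. Set $2_\bullet=1$, and for $2<j\le n$ let $j_\bullet$ be the maximal sink or source of $Q_\xi$ (in this sense, so vertex $1$ always counts) satisfying $j_\bullet<j$. The symbol $1_\bullet$ is read as $0$. Cluster algebra. $\mathcal A(\mathbf x,Q_\xi)$ is the cluster algebra with initial seed $(\mathbf x,Q_\xi)$,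 $\mathbf x=\{x_1,\dots,x_n,f_1,\dots,f_n\}$ algebraically independent, $f_i$ the frozen variable at $i'$. With $\alpha_1,\dots,\alpha_n$ simple roots of type $A_n$ and $\alpha_{i,j}=\alpha_i+\dots+\alpha_j$, $x[\alpha_{i,j}]$ is the cluster variable with denominator $x_ix_{i+1}\cdots x_j$ with respect to $x_1,\dots,x_n$ (obtained from the initial seed by mutating successively at $i,i+1,\dots,j$). Conventions: $x_0=x_{n+1}=1$; $f_{n+1}$ only occurs with exponent $0$. The sets $\Gamma_{i,j}$ ($i\le j$). $\Gamma_{i,j}\subset\mathbb Z_+^{j-i+2}$ ($\mathbb Z_+$ the non-negative integers) is the set of $\boldsymbol\epsilon=(\epsilon_i,\dots,\epsilon_{j+1})$ such that, writing $\sigma_{r,m}(\boldsymbol\epsilon)=\epsilon_r+\dots+\epsilon_m$ for $i\le r\le m\le j+1$: • $\epsilon_{j+1}=1+(d_j-1)\,\sigma_{\max\{i,j_\bullet+1\},j}(\boldsymbol\epsilon)$; • $\sigma_{\max\{i,j_\bullet+1\},j}(\boldsymbol\epsilon)\le1$; • if $i_\diamond\le j$: $\sigma_{i,i_\diamond}(\boldsymbol\epsilon)\le1\le\sigma_{i,i_\diamond+1}(\boldsymbol\epsilon)$; • for every $m$ with $i_\diamond\le m=m_\diamond<j_\bullet$: $\sigma_{m+1,(m+1)_\diamond}(\boldsymbol\epsilon)\le1\le\sigma_{m+1,(m+1)_\diamond+1}(\boldsymbol\epsilon)$. The map $p_{i,j}:\Gamma_{i,j}\to\mathbb Z^{j-i+2}$,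 $p_{i,j}(\epsilon_i,\dots,\epsilon_{j+1})=(\epsilon_i',\dots,\epsilon_{j+1}')$, is defined by: • $\epsilon_{j+1}'=(1-d_j)\,\sigma_{\max\{i,j_\bullet+1\},j}(\boldsymbol\epsilon)+d_j\big(1-\sigma_{\max\{i,j_\bullet+1\},j}(\boldsymbol\epsilon)\big)$; • for $i\le m\le j$, if $i_\bullet=m_\bullet$ or $\sigma_{\max\{i,(m_\bullet)_\bullet+1\},m_\bullet}(\boldsymbol\epsilon)=1$, then $\epsilon_m'=(d_m-1)\epsilon_{m+1}-d_m$ when $\sigma_{\max\{i,m_\bullet+1\},m}(\boldsymbol\epsilon)=0$, and $\epsilon_m'=d_m-(\epsilon_m+\epsilon_{m+1})$ when $\sigma_{\max\{i,m_\bullet+1\},m}(\boldsymbol\epsilon)=1$; • for $i\le m\le j$, if $m_\bullet\ge i$ and $\sigma_{\max\{i,(m_\bullet)_\bullet+1\},m_\bullet}(\boldsymbol\epsilon)=0$, then $\epsilon_m'=d_m(1-\epsilon_{m+1})$.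
   Formalization: When i=1 and 1_⋄≠1 (n≥3, ξ(1)≠ξ(3)), a value j_•=1 is read as 0 in Γ_{1,j} and p_{1,j}; as written the formula fails there, e.g. n=3, ξ=(2,1,0), i=1, j=2, where ε=(0,0,1) would give x_3 instead of x_3/x_2. *)

theory Defs
  imports Complex_Main "HOL-Library.FuncSet" "HOL-Library.Poly_Mapping"
begin

section \<open>Quivers with frozen vertices and seed mutation\<close>

text \<open>\<open>Mut k\<close> is the vertex \<open>k\<close>, \<open>Frz k\<close> the frozen vertex \<open>k'\<close>. A quiver is given by its arrow
  multiplicities: \<open>Q a b\<close> is the number of arrows from \<open>a\<close> to \<open>b\<close>. In a seed \<open>(X, Q)\<close>, \<open>X\<close> carries
  both the cluster variables \<open>X (Mut k)\<close> and the frozen variables \<open>X (Frz k)\<close>.\<close>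

datatype vertex = Mut nat | Frz nat

fun frozen :: "vertex \<Rightarrow> bool" where
  "frozen (Mut k) = False"
| "frozen (Frz k) = True"

definition vertices :: "nat \<Rightarrow> vertex set" where
  "vertices n = Mut ` {1..n} \<union> Frz ` {1..n}"

type_synonym quiver = "vertex \<Rightarrow> vertex \<Rightarrow> nat"
type_synonym 'a seed = "(vertex \<Rightarrow> 'a) \<times> quiver"

text \<open>For quivers without loops and 2-cycles: add an arrow \<open>a \<rightarrow> b\<close> for each path \<open>a \<rightarrow> k \<rightarrow> b\<close>, reverse
  the arrows at \<open>k\<close>, cancel 2-cycles (this is the truncated subtraction on \<open>nat\<close>); arrows between
  frozen vertices are discarded.\<close>

definition mutate_quiver :: "nat \<Rightarrow> quiver \<Rightarrow> quiver" where
  "mutate_quiver k Q a b =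
     (if a = Mut k \<or> b = Mut k then Q b a
      else if frozen a \<and> frozen b then 0
      else (Q a b + Q a (Mut k) * Q (Mut k) b) - (Q b a + Q b (Mut k) * Q (Mut k) a))"

definition mutate_seed :: "nat \<Rightarrow> nat \<Rightarrow> 'a::field seed \<Rightarrow> 'a seed" where
  "mutate_seed n k S = (case S of (X, Q) \<Rightarrow>
     (X(Mut k := ((\<Prod>a\<in>vertices n. X a ^ Q a (Mut k)) + (\<Prod>b\<in>vertices n. X b ^ Q (Mut k) b))
                   / X (Mut k)),
      mutate_quiver k Q))"

text \<open>Algebraic independence over \<open>\<rat>\<close> of the family \<open>X\<close> indexed by \<open>V\<close>; the exponents
  and coefficients of polynomials in variables indexed by \<open>'v\<close> are encoded by
  \<open>('v \<Rightarrow>\<^sub>0 nat) \<Rightarrow>\<^sub>0 rat\<close>.\<close>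

definition algebraically_independent :: "'v set \<Rightarrow> ('v \<Rightarrow> 'a::field_char_0) \<Rightarrow> bool" where
  "algebraically_independent V X \<longleftrightarrow>
     (\<forall>p :: ('v \<Rightarrow>\<^sub>0 nat) \<Rightarrow>\<^sub>0 rat.
        (\<forall>e \<in> Poly_Mapping.keys p. Poly_Mapping.keys e \<subseteq> V) \<longrightarrow>
        (\<Sum>e \<in> Poly_Mapping.keys p.
           of_rat (Poly_Mapping.lookup p e) *
           (\<Prod>v \<in> Poly_Mapping.keys e. X v ^ Poly_Mapping.lookup e v)) = 0 \<longrightarrow>
        p = 0)"

inductive_set generated_subring :: "'a::comm_ring_1 set \<Rightarrow> 'a set" for S :: "'a set" where
  one: "1 \<in> generated_subring S"
| incl: "s \<in> S \<Longrightarrow> s \<in> generated_subring S"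
| diff: "a \<in> generated_subring S \<Longrightarrow> b \<in> generated_subring S \<Longrightarrow> a - b \<in> generated_subring S"
| mult: "a \<in> generated_subring S \<Longrightarrow> b \<in> generated_subring S \<Longrightarrow> a * b \<in> generated_subring S"

text \<open>\<open>z\<close> has denominator \<open>x\<^sub>1\<^bsup>d 1\<^esup> \<cdots> x\<^sub>n\<^bsup>d n\<^esup>\<close> with respect to \<open>x\<^sub>1, \<dots>, x\<^sub>n\<close>: it is \<open>N\<close> divided by this
  monomial for a polynomial \<open>N\<close> in the initial cluster and frozen variables which is not divisible
  by any of \<open>x\<^sub>1, \<dots>, x\<^sub>n\<close>.\<close>

definition has_denominator :: "nat \<Rightarrow> (vertex \<Rightarrow> 'a::field) \<Rightarrow> 'a \<Rightarrow> (nat \<Rightarrow> nat) \<Rightarrow> bool" where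
  "has_denominator n X z d \<longleftrightarrow>
     (\<exists>N \<in> generated_subring (X ` vertices n).
        z = N / (\<Prod>k\<in>{1..n}. X (Mut k) ^ d k) \<and>
        (\<forall>k\<in>{1..n}. \<not> (\<exists>M \<in> generated_subring (X ` vertices n). N = X (Mut k) * M)))"


section \<open>Height functions and the quiver \<open>Q\<^sub>\<xi>\<close>\<close>

definition height_function :: "nat \<Rightarrow> (nat \<Rightarrow> int) \<Rightarrow> bool" where
  "height_function n \<xi> \<longleftrightarrow> (\<forall>i\<in>{2..n}. \<bar>\<xi> i - \<xi> (i - 1)\<bar> = 1)"

definition extend :: "nat \<Rightarrow> (nat \<Rightarrow> int) \<Rightarrow> nat \<Rightarrow> int" where
  "extend n \<xi> = \<xi>(0 := \<xi> 2, n + 1 := \<xi> (n - 1))"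

text \<open>\<open>diamond n \<xi> i\<close> is \<open>i\<^sub>\<diamond>\<close>.\<close>

definition diamond :: "nat \<Rightarrow> (nat \<Rightarrow> int) \<Rightarrow> nat \<Rightarrow> nat" where
  "diamond n \<xi> i =
     (if i + 2 \<le> n then (LEAST m. m \<in> {i..n} \<and> extend n \<xi> m = extend n \<xi> (m + 2)) else i)"

definition dd :: "nat \<Rightarrow> (nat \<Rightarrow> int) \<Rightarrow> nat \<Rightarrow> int" where
  "dd n \<xi> j = (if j = diamond n \<xi> j then 1 else 0)"

text \<open>The edges at \<open>j\<close>, oriented as for \<open>\<xi> j = \<xi> (j + 1) + 1\<close> (respectively
  \<open>\<xi> (n - 1) = \<xi> n + 1\<close> if \<open>j = n\<close>).\<close>

definition edges_at :: "nat \<Rightarrow> (nat \<Rightarrow> int) \<Rightarrow> nat \<Rightarrow> (vertex \<times> vertex) set" where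
  "edges_at n \<xi> j =
     (if j = n then {(Mut (n - 1), Mut n), (Mut n, Frz n)}
      else (if 2 \<le> j then {(Mut j, Mut (j - 1))} else {})
         \<union> {(Frz j, Mut j)}
         \<union> (if j = diamond n \<xi> j then {(Mut j, Mut (j + 1))}
            else {(Mut (j + 1), Mut j), (Mut j, Frz (j + 1))}))"

definition descends_at :: "nat \<Rightarrow> (nat \<Rightarrow> int) \<Rightarrow> nat \<Rightarrow> bool" where
  "descends_at n \<xi> j \<longleftrightarrow> (if j = n then \<xi> (n - 1) = \<xi> n + 1 else \<xi> j = \<xi> (j + 1) + 1)"

definition arrows :: "nat \<Rightarrow> (nat \<Rightarrow> int) \<Rightarrow> (vertex \<times> vertex) set" where
  "arrows n \<xi> =
     (\<Union>j\<in>{1..n}. if descends_at n \<xi> j then edges_at n \<xi> j else (edges_at n \<xi> j)\<inverse>)"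

definition Q_height :: "nat \<Rightarrow> (nat \<Rightarrow> int) \<Rightarrow> quiver" where
  "Q_height n \<xi> a b = (if (a, b) \<in> arrows n \<xi> then 1 else 0)"

text \<open>\<open>x_root n \<xi> X i j\<close> is \<open>x[\<alpha>\<^sub>i\<^sub>,\<^sub>j]\<close>: the variable at \<open>j\<close> after mutating the initial seed
  \<open>(X, Q\<^sub>\<xi>)\<close> successively at \<open>i, i + 1, \<dots>, j\<close>.\<close>

definition x_root :: "nat \<Rightarrow> (nat \<Rightarrow> int) \<Rightarrow> (vertex \<Rightarrow> 'a::field) \<Rightarrow> nat \<Rightarrow> nat \<Rightarrow> 'a" where
  "x_root n \<xi> X i j = fst (fold (mutate_seed n) [i..<Suc j] (X, Q_height n \<xi>)) (Mut j)"


section \<open>The sets \<open>\<Gamma>\<^sub>i\<^sub>,\<^sub>j\<close> and the maps \<open>p\<^sub>i\<^sub>,\<^sub>j\<close>\<close>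

definition sink_or_source :: "nat \<Rightarrow> (nat \<Rightarrow> int) \<Rightarrow> nat \<Rightarrow> bool" where
  "sink_or_source n \<xi> j \<longleftrightarrow>
     (\<forall>k\<in>{1..n}. Q_height n \<xi> (Mut j) (Mut k) = 0) \<or>
     (\<forall>k\<in>{1..n}. Q_height n \<xi> (Mut k) (Mut j) = 0)"

text \<open>\<open>bullet n \<xi> j\<close> is \<open>j\<^sub>\<bullet>\<close>. Vertex 1 has a single unfrozen neighbour, so it is always a
  sink or source, and \<open>2\<^sub>\<bullet> = 1\<close>.\<close>

definition bullet :: "nat \<Rightarrow> (nat \<Rightarrow> int) \<Rightarrow> nat \<Rightarrow> nat" where
  "bullet n \<xi> j = (if j \<le> 1 then 0 else Max {k \<in> {1..<j}. sink_or_source n \<xi> k})"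

text \<open>The symbol \<open>j\<^sub>\<bullet>\<close> as it is used in \<open>\<Gamma>\<^sub>i\<^sub>,\<^sub>j\<close> and \<open>p\<^sub>i\<^sub>,\<^sub>j\<close>. It is \<open>bullet n \<xi> j\<close>, except that if
  \<open>i = 1 \<noteq> 1\<^sub>\<diamond>\<close> then vertex 1 does not count, i.e. the value 1 is read as 0.
  Without this exception the expansion formula would fail: take \<open>n = 3\<close>, \<open>\<xi> = (2, 1, 0)\<close>, \<open>i = 1\<close>,
  \<open>j = 2\<close>, where \<open>x[\<alpha>\<^sub>1\<^sub>,\<^sub>2] = (f\<^sub>1 x\<^sub>2 + f\<^sub>2 + x\<^sub>1 x\<^sub>3) / (x\<^sub>1 x\<^sub>2)\<close>, but with \<open>2\<^sub>\<bullet> = 1\<close> the element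
  \<open>(0, 0, 1)\<close> of \<open>\<Gamma>\<^sub>1\<^sub>,\<^sub>2\<close> would contribute \<open>x\<^sub>3\<close> instead of \<open>x\<^sub>3 / x\<^sub>2\<close>; for \<open>\<xi> = (3, 2, 1, 0)\<close> the
  set \<open>\<Gamma>\<^sub>1\<^sub>,\<^sub>2\<close> would even be infinite.\<close>

definition bullet_from :: "nat \<Rightarrow> (nat \<Rightarrow> int) \<Rightarrow> nat \<Rightarrow> nat \<Rightarrow> nat" where
  "bullet_from n \<xi> i j =
     (if i = 1 \<and> diamond n \<xi> 1 \<noteq> 1 \<and> bullet n \<xi> j = 1 then 0 else bullet n \<xi> j)"

text \<open>A tuple \<open>(\<epsilon>\<^sub>i, \<dots>, \<epsilon>\<^sub>j\<^sub>+\<^sub>1)\<close> is an extensional function on \<open>{i..j + 1}\<close>.\<close>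

definition sigma :: "nat \<Rightarrow> nat \<Rightarrow> (nat \<Rightarrow> int) \<Rightarrow> int" where
  "sigma r m \<epsilon> = (\<Sum>t=r..m. \<epsilon> t)"

text \<open>The last block sum \<open>\<sigma>\<close> from \<open>max {i, m\<^sub>\<bullet> + 1}\<close> to \<open>m\<close>.\<close>

definition block_sum :: "nat \<Rightarrow> (nat \<Rightarrow> int) \<Rightarrow> nat \<Rightarrow> nat \<Rightarrow> (nat \<Rightarrow> int) \<Rightarrow> int" where
  "block_sum n \<xi> i m \<epsilon> = sigma (max i (bullet_from n \<xi> i m + 1)) m \<epsilon>"

definition Gam :: "nat \<Rightarrow> (nat \<Rightarrow> int) \<Rightarrow> nat \<Rightarrow> nat \<Rightarrow> (nat \<Rightarrow> int) set" where
  "Gam n \<xi> i j = {\<epsilon> \<in> {i..j + 1} \<rightarrow>\<^sub>E {0..}.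
     \<epsilon> (j + 1) = 1 + (dd n \<xi> j - 1) * block_sum n \<xi> i j \<epsilon> \<and>
     block_sum n \<xi> i j \<epsilon> \<le> 1 \<and>
     (diamond n \<xi> i \<le> j \<longrightarrow>
        sigma i (diamond n \<xi> i) \<epsilon> \<le> 1 \<and> 1 \<le> sigma i (diamond n \<xi> i + 1) \<epsilon>) \<and>
     (\<forall>m. diamond n \<xi> i \<le> m \<and> m = diamond n \<xi> m \<and> m < bullet_from n \<xi> i j \<longrightarrow>
        sigma (m + 1) (diamond n \<xi> (m + 1)) \<epsilon> \<le> 1 \<and>
        1 \<le> sigma (m + 1) (diamond n \<xi> (m + 1) + 1) \<epsilon>)}"

text \<open>\<open>p_map n \<xi> i j \<epsilon> m\<close> is \<open>\<epsilon>'\<^sub>m\<close>; only its values for \<open>\<epsilon> \<in> \<Gamma>\<^sub>i\<^sub>,\<^sub>j\<close> and \<open>m \<in> {i..j + 1}\<close> are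
  meaningful.\<close>

definition p_map :: "nat \<Rightarrow> (nat \<Rightarrow> int) \<Rightarrow> nat \<Rightarrow> nat \<Rightarrow> (nat \<Rightarrow> int) \<Rightarrow> nat \<Rightarrow> int" where
  "p_map n \<xi> i j \<epsilon> m =
     (let b = bullet_from n \<xi> i; d = dd n \<xi> in
      if m = j + 1 then
        (1 - d j) * block_sum n \<xi> i j \<epsilon> + d j * (1 - block_sum n \<xi> i j \<epsilon>)
      else if b i = b m \<or> block_sum n \<xi> i (b m) \<epsilon> = 1 then
        (if block_sum n \<xi> i m \<epsilon> = 0 then (d m - 1) * \<epsilon> (m + 1) - d m
         else if block_sum n \<xi> i m \<epsilon> = 1 then d m - (\<epsilon> m + \<epsilon> (m + 1))
         else undefined)
      else if i \<le> b m \<and> block_sum n \<xi> i (b m) \<epsilon> = 0 then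
        d m * (1 - \<epsilon> (m + 1))
      else undefined)"

text \<open>The convention \<open>x\<^sub>0 = x\<^sub>n\<^sub>+\<^sub>1 = 1\<close>.\<close>

definition x_ext :: "nat \<Rightarrow> (vertex \<Rightarrow> 'a::field) \<Rightarrow> nat \<Rightarrow> 'a" where
  "x_ext n X k = (if k \<in> {1..n} then X (Mut k) else 1)"

definition m_mono ::
  "nat \<Rightarrow> (nat \<Rightarrow> int) \<Rightarrow> (vertex \<Rightarrow> 'a::field) \<Rightarrow> nat \<Rightarrow> nat \<Rightarrow> (nat \<Rightarrow> int) \<Rightarrow> 'a" where
  "m_mono n \<xi> X i j \<epsilon> =
     x_ext n X (i - 1) powi (1 - \<epsilon> i) * (\<Prod>m=i..j + 1. x_ext n X m powi p_map n \<xi> i j \<epsilon> m)"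

definition f_mono ::
  "nat \<Rightarrow> (nat \<Rightarrow> int) \<Rightarrow> (vertex \<Rightarrow> 'a::field) \<Rightarrow> nat \<Rightarrow> nat \<Rightarrow> (nat \<Rightarrow> int) \<Rightarrow> 'a" where
  "f_mono n \<xi> X i j \<epsilon> =
     (\<Prod>m=i..j. X (Frz m) powi \<epsilon> m) * X (Frz (j + 1)) powi ((1 - dd n \<xi> j) * \<epsilon> (j + 1))"

end

theory Submission
  imports Defs
begin

text \<open>After mutating at \<open>i, \<dots>, j - 1\<close>, one of the two monomials of the exchange relation at \<open>j\<close>
  contains the previous cluster variable, the other one is inherited from the last vertex \<open>k < j\<close>
  with \<open>k = k\<^sub>\<diamond>\<close>, so \<open>x[\<alpha>\<^sub>i\<^sub>,\<^sub>j]\<close> satisfies a recursion with two terms \<open>p, q\<close> that depends only on the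
  bits \<open>d\<^sub>i, \<dots>, d\<^sub>j\<close>. Reading a tuple of \<open>\<Gamma>\<^sub>i\<^sub>,\<^sub>j\<close> from left to right, the sum of the entries in the
  current block is 0 or 1, and appending an entry multiplies the monomial by a factor determined
  by this state. The weighted sums over the tuples in state 1 and in state 0 satisfy the recursion
  for \<open>p\<close> and \<open>q\<close>. For the denominator, set \<open>x\<^sub>k = 0\<close> and all other variables to 1: the numerator
  stays positive, hence is not divisible by \<open>x\<^sub>k\<close>.\<close>

section \<open>Specialisation of algebraically independent elements\<close>

definition monom_value :: "('v \<Rightarrow> 'a::comm_ring_1) \<Rightarrow> ('v \<Rightarrow>\<^sub>0 nat) \<Rightarrow> 'a" where
  "monom_value X e = (\<Prod>v\<in>Poly_Mapping.keys e. X v ^ Poly_Mapping.lookup e v)"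

definition poly_value :: "('v \<Rightarrow> 'a::field_char_0) \<Rightarrow> (('v \<Rightarrow>\<^sub>0 nat) \<Rightarrow>\<^sub>0 rat) \<Rightarrow> 'a" where
  "poly_value X p =
     (\<Sum>e\<in>Poly_Mapping.keys p. of_rat (Poly_Mapping.lookup p e) * monom_value X e)"

lemma monom_value_superset:
  assumes "finite A" "Poly_Mapping.keys e \<subseteq> A"
  shows "monom_value X e = (\<Prod>v\<in>A. X v ^ Poly_Mapping.lookup e v)"
  unfolding monom_value_def using assms
  by (intro prod.mono_neutral_left) (auto simp: in_keys_iff)

lemma monom_value_0 [simp]: "monom_value X 0 = 1"
  by (simp add: monom_value_def)

lemma monom_value_add: "monom_value X (e + e') = monom_value X e * monom_value X e'"
proof -
  let ?A = "Poly_Mapping.keys e \<union> Poly_Mapping.keys e'"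
  have "monom_value X (e + e') = (\<Prod>v\<in>?A. X v ^ Poly_Mapping.lookup (e + e') v)"
    by (intro monom_value_superset) (auto simp: in_keys_iff lookup_add)
  also have "\<dots> = (\<Prod>v\<in>?A. X v ^ Poly_Mapping.lookup e v) * (\<Prod>v\<in>?A. X v ^ Poly_Mapping.lookup e' v)"
    by (simp add: lookup_add power_add prod.distrib)
  also have "\<dots> = monom_value X e * monom_value X e'"
    by (simp add: monom_value_superset[of ?A])
  finally show ?thesis .
qed

lemma poly_value_superset:
  assumes "finite A" "Poly_Mapping.keys p \<subseteq> A"
  shows "poly_value X p = (\<Sum>e\<in>A. of_rat (Poly_Mapping.lookup p e) * monom_value X e)"
  unfolding poly_value_def using assms
  by (intro sum.mono_neutral_left) (auto simp: in_keys_iff)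

lemma poly_value_0 [simp]: "poly_value X 0 = 0"
  by (simp add: poly_value_def)

lemma poly_value_single: "poly_value X (Poly_Mapping.single e c) = of_rat c * monom_value X e"
  by (simp add: poly_value_def)

lemma poly_value_add: "poly_value X (p + q) = poly_value X p + poly_value X q"
proof -
  let ?A = "Poly_Mapping.keys p \<union> Poly_Mapping.keys q"
  have "poly_value X (p + q) = (\<Sum>e\<in>?A. of_rat (Poly_Mapping.lookup (p + q) e) * monom_value X e)"
    using keys_add[of p q] by (intro poly_value_superset) auto
  then show ?thesis
    by (simp add: poly_value_superset[of ?A] lookup_add of_rat_add distrib_right sum.distrib)
qed

lemma poly_value_diff: "poly_value X (p - q) = poly_value X p - poly_value X q"
  using poly_value_add[of X "p - q" q] by simp

lemma update_eq_add_single: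
  "a \<notin> Poly_Mapping.keys p \<Longrightarrow> Poly_Mapping.update a c p = p + Poly_Mapping.single a c"
  by (rule poly_mapping_eqI) (auto simp: lookup_update lookup_add lookup_single in_keys_iff when_def)

text \<open>Additive induction: since evaluation is additive, multiplicativity only has to be
  checked on a product of two single terms.\<close>

lemma poly_mapping_induct_single:
  fixes p :: "'k \<Rightarrow>\<^sub>0 'c::comm_monoid_add"
  assumes "\<And>k c. P (Poly_Mapping.single k c)" "\<And>p q. P p \<Longrightarrow> P q \<Longrightarrow> P (p + q)"
  shows "P p"
proof (induction p rule: update_induct)
  case const
  show ?case using assms(1)[of undefined 0] by simp
next
  case (update p a c)
  then show ?case using assms by (simp add: update_eq_add_single)
qed

lemma poly_value_mult: "poly_value X (p * q) = poly_value X p * poly_value X q"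
proof (induction p rule: poly_mapping_induct_single)
  case (1 e c)
  show ?case
  proof (induction q rule: poly_mapping_induct_single)
    case (1 e' c')
    then show ?case by (simp add: mult_single poly_value_single monom_value_add of_rat_mult)
  next
    case (2 q1 q2)
    then show ?case by (simp add: poly_value_add algebra_simps)
  qed
next
  case (2 p1 p2)
  then show ?case by (simp add: poly_value_add algebra_simps)
qed

text \<open>The graph of the ring homomorphism that sends \<open>X v\<close> to \<open>t v\<close>; algebraic independence makes
  it single-valued.\<close>

inductive specialises :: "'v set \<Rightarrow> ('v \<Rightarrow> 'a::comm_ring_1) \<Rightarrow> ('v \<Rightarrow> 'b::comm_ring_1) \<Rightarrow> 'a \<Rightarrow> 'b \<Rightarrow> bool"
  for V X t where
  one: "specialises V X t 1 1"
| var: "v \<in> V \<Longrightarrow> specialises V X t (X v) (t v)"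
| diff: "specialises V X t a a' \<Longrightarrow> specialises V X t b b' \<Longrightarrow> specialises V X t (a - b) (a' - b')"
| mult: "specialises V X t a a' \<Longrightarrow> specialises V X t b b' \<Longrightarrow> specialises V X t (a * b) (a' * b')"

lemma specialises_add:
  assumes "specialises V X t a a'" "specialises V X t b b'"
  shows "specialises V X t (a + b) (a' + b')"
proof -
  \<comment> \<open>The relation is closed under differences only, so 0 is written as
    \<open>1 - 1\<close> and the sum as a double difference.\<close>
  have "specialises V X t (a - ((1 - 1) - b)) (a' - ((1 - 1) - b'))"
    using assms by (intro specialises.intros)
  then show ?thesis by simp
qed

lemma specialises_in_subring: "specialises V X t a a' \<Longrightarrow> a \<in> generated_subring (X ` V)"
  by (induction rule: specialises.induct) (auto intro: generated_subring.intros)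

lemma subring_specialises: "a \<in> generated_subring (X ` V) \<Longrightarrow> \<exists>a'. specialises V X t a a'"
  by (induction rule: generated_subring.induct) (blast intro: specialises.intros)+

text \<open>Each derivation is witnessed by one polynomial over \<open>V\<close> evaluated at both
  families; the rules of the relation become operations on these polynomials.\<close>

lemma specialises_poly:
  fixes X :: "'v \<Rightarrow> 'a::field_char_0" and t :: "'v \<Rightarrow> 'b::field_char_0"
  assumes "specialises V X t a a'"
  shows "\<exists>p. (\<forall>e\<in>Poly_Mapping.keys p. Poly_Mapping.keys e \<subseteq> V) \<and> poly_value X p = a \<and> poly_value t p = a'"
  using assms
proof (induction rule: specialises.induct)
  case one
  show ?case
    by (rule exI[of _ 1]) (simp add: poly_value_single flip: single_one)
next
  case (var v)
  show ?case
    by (rule exI[of _ "Poly_Mapping.single (Poly_Mapping.single v 1) 1"])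
      (use var in \<open>simp add: poly_value_single monom_value_def\<close>)
next
  case (diff a a' b b')
  then obtain p q where "\<forall>e\<in>Poly_Mapping.keys p. Poly_Mapping.keys e \<subseteq> V" "poly_value X p = a" "poly_value t p = a'"
    "\<forall>e\<in>Poly_Mapping.keys q. Poly_Mapping.keys e \<subseteq> V" "poly_value X q = b" "poly_value t q = b'"
    by blast
  then show ?case
    using keys_diff[of p q] by (intro exI[of _ "p - q"]) (auto simp: poly_value_diff)
next
  case (mult a a' b b')
  then obtain p q where pq: "\<forall>e\<in>Poly_Mapping.keys p. Poly_Mapping.keys e \<subseteq> V" "poly_value X p = a" "poly_value t p = a'"
    "\<forall>e\<in>Poly_Mapping.keys q. Poly_Mapping.keys e \<subseteq> V" "poly_value X q = b" "poly_value t q = b'"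
    by blast
  have "Poly_Mapping.keys e \<subseteq> V" if e: "e \<in> Poly_Mapping.keys (p * q)" for e
  proof -
    obtain e1 e2 where "e = e1 + e2" "e1 \<in> Poly_Mapping.keys p" "e2 \<in> Poly_Mapping.keys q"
      using subsetD[OF keys_mult e] by blast
    then show ?thesis using pq keys_add[of e1 e2] by blast
  qed
  then show ?case
    using pq by (intro exI[of _ "p * q"]) (auto simp: poly_value_mult)
qed

text \<open>Subtracting the two derivations relates 0 to \<open>b - c\<close>. The witnessing
  polynomial vanishes at \<open>X\<close>, so it is the zero polynomial, and its value at
  \<open>t\<close> is 0 as well.\<close>

lemma specialises_unique:
  fixes X :: "'v \<Rightarrow> 'a::field_char_0" and t :: "'v \<Rightarrow> 'b::field_char_0"
  assumes "algebraically_independent V X" "specialises V X t a b" "specialises V X t a c"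
  shows "b = c"
proof -
  have "specialises V X t (a - a) (b - c)"
    using assms by (intro specialises.diff)
  then obtain p where "\<forall>e\<in>Poly_Mapping.keys p. Poly_Mapping.keys e \<subseteq> V" "poly_value X p = 0"
    "poly_value t p = b - c"
    using specialises_poly by fastforce
  moreover from this have "p = 0"
    using assms(1) by (simp add: algebraically_independent_def poly_value_def monom_value_def)
  ultimately show ?thesis
    by simp
qed

lemma algebraically_independent_nonzero:
  fixes X :: "'v \<Rightarrow> 'a::field_char_0"
  assumes "algebraically_independent V X" "v \<in> V"
  shows "X v \<noteq> 0"
proof
  assume "X v = 0"
  \<comment> \<open>An element \<open>X v = 0\<close> would specialise to \<open>1 - 1\<close> as
    well as to its assigned value 1.\<close>
  then have "specialises V X (\<lambda>_. 1 :: rat) (X v) (1 - 1)"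
    by (metis specialises.diff specialises.one diff_self)
  with specialises.var[OF assms(2), of X "\<lambda>_. 1 :: rat"] show False
    using specialises_unique[OF assms(1)] by fastforce
qed

section \<open>Combinatorics of the quiver\<close>

lemma vertices_simps [simp]:
  "Mut k \<in> vertices n \<longleftrightarrow> 1 \<le> k \<and> k \<le> n" "Frz k \<in> vertices n \<longleftrightarrow> 1 \<le> k \<and> k \<le> n"
  by (auto simp: vertices_def)

lemma finite_vertices [simp]: "finite (vertices n)"
  by (simp add: vertices_def)

text \<open>At the vertex being mutated all arrow multiplicities are 0 or 1, which turns an exchange
  monomial into a product over a set of neighbours.\<close>

lemma prod_power_of_bool:
  assumes "finite V" "A \<subseteq> V"
  shows "(\<Prod>a\<in>V. X a ^ of_bool (a \<in> A)) = prod X A"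
proof -
  have "(\<Prod>a\<in>V. X a ^ of_bool (a \<in> A)) = (\<Prod>a\<in>A. X a ^ of_bool (a \<in> A))"
    using assms by (intro prod.mono_neutral_right) auto
  then show ?thesis by simp
qed

section \<open>Turns of the height function and the orientation of the arrows\<close>

locale height_quiver =
  fixes n :: nat and \<xi> :: "nat \<Rightarrow> int"
  assumes n_ge_2: "2 \<le> n" and height: "height_function n \<xi>"
begin

text \<open>The condition d_j = 1. For \<open>1 \<le> j < n\<close> it says that the extended height
  function has a local extremum at j + 1; vertex n is a turn by convention.\<close>

definition turn :: "nat \<Rightarrow> bool" where
  "turn j \<longleftrightarrow> diamond n \<xi> j = j"

lemma eq_diamond_iff: "j = diamond n \<xi> j \<longleftrightarrow> turn j"
  by (auto simp: turn_def)

lemma dd_eq: "dd n \<xi> j = of_bool (turn j)"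
  by (simp add: dd_def eq_diamond_iff)

lemma height_step: "1 \<le> j \<Longrightarrow> j < n \<Longrightarrow> \<xi> (Suc j) = \<xi> j + 1 \<or> \<xi> (Suc j) = \<xi> j - 1"
  using height unfolding height_function_def by (auto dest!: bspec[of _ _ "Suc j"])

text \<open>The extension of \<xi> to n + 1 makes n - 1 a candidate, so the \<open>LEAST\<close> in
  \<open>diamond\<close> is attained.\<close>

lemma extend_turn_exists:
  assumes "i + 2 \<le> n"
  shows "n - 1 \<in> {i..n} \<and> extend n \<xi> (n - 1) = extend n \<xi> (n - 1 + 2)"
  using assms by (auto simp: extend_def)

lemma diamond_bounds:
  assumes "i \<le> n"
  shows "i \<le> diamond n \<xi> i" "diamond n \<xi> i \<le> n"
  using LeastI[of "\<lambda>m. m \<in> {i..n} \<and> extend n \<xi> m = extend n \<xi> (m + 2)", OF extend_turn_exists] assms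
  by (auto simp: diamond_def)

lemma turn_last [simp]: "turn n" "turn (n - 1)"
  using n_ge_2 by (auto simp: turn_def diamond_def)

lemma turn_iff:
  assumes "1 \<le> j" "j < n"
  shows "turn j \<longleftrightarrow> extend n \<xi> j = extend n \<xi> (j + 2)"
proof (cases "j + 2 \<le> n")
  case True
  let ?P = "\<lambda>m. m \<in> {j..n} \<and> extend n \<xi> m = extend n \<xi> (m + 2)"
  have "?P (LEAST m. ?P m)" using extend_turn_exists[OF True] by (rule LeastI)
  moreover have "(LEAST m. ?P m) = j" if "?P j"
    using that by (intro Least_equality) auto
  ultimately show ?thesis using True by (auto simp: turn_def diamond_def)
next
  case False
  with assms have "j = n - 1" by simp
  then show ?thesis using n_ge_2 turn_last by (auto simp: extend_def)
qed

lemma turn_iff_height: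
  assumes "1 \<le> j" "j + 2 \<le> n"
  shows "turn j \<longleftrightarrow> \<xi> j = \<xi> (j + 2)"
  using assms by (subst turn_iff) (auto simp: extend_def)

lemma diamond_eqI:
  assumes "1 \<le> i" "i \<le> m" "m \<le> n" "turn m" "\<And>k. i \<le> k \<Longrightarrow> k < m \<Longrightarrow> \<not> turn k"
  shows "diamond n \<xi> i = m"
proof (cases "i + 2 \<le> n")
  case True
  \<comment> \<open>The turn n - 1 lies in the range and would come before n.\<close>
  have "m \<noteq> n" using assms(5)[of "n - 1"] True turn_last(2) by fastforce
  with assms have "m < n" by simp
  have "(LEAST m. m \<in> {i..n} \<and> extend n \<xi> m = extend n \<xi> (m + 2)) = m"
  proof (rule Least_equality)
    show "m \<in> {i..n} \<and> extend n \<xi> m = extend n \<xi> (m + 2)"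
      using assms turn_iff[of m] \<open>m < n\<close> by auto
    show "m \<le> k" if "k \<in> {i..n} \<and> extend n \<xi> k = extend n \<xi> (k + 2)" for k
      using that assms turn_iff[of k] \<open>m < n\<close> by (meson atLeastAtMost_iff le_trans less_le_not_le linorder_not_less)
  qed
  with True show ?thesis by (simp add: diamond_def)
next
  case False
  then have "diamond n \<xi> i = i" by (simp add: diamond_def)
  moreover from this have "\<not> i < m" using assms(5)[of i] by (auto simp: turn_def)
  ultimately show ?thesis using assms by simp
qed

lemma turn_diamond:
  assumes "1 \<le> i" "i \<le> n"
  shows "turn (diamond n \<xi> i)" and "\<And>k. i \<le> k \<Longrightarrow> k < diamond n \<xi> i \<Longrightarrow> \<not> turn k"
proof -
  define m where "m = (LEAST m. i \<le> m \<and> turn m)"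
  have "i \<le> m \<and> turn m" unfolding m_def using assms LeastI[of "\<lambda>m. i \<le> m \<and> turn m" n] by simp
  moreover have "\<not> turn k" if "i \<le> k" "k < m" for k
    using not_less_Least[of k "\<lambda>m. i \<le> m \<and> turn m"] that by (simp add: m_def)
  moreover have "m \<le> n" unfolding m_def using assms Least_le[of "\<lambda>m. i \<le> m \<and> turn m" n] by simp
  ultimately have "diamond n \<xi> i = m" "turn m" "\<And>k. i \<le> k \<Longrightarrow> k < m \<Longrightarrow> \<not> turn k"
    using diamond_eqI[of i m] assms by auto
  then show "turn (diamond n \<xi> i)" "\<And>k. i \<le> k \<Longrightarrow> k < diamond n \<xi> i \<Longrightarrow> \<not> turn k"
    by simp_all
qed

definition down :: "nat \<Rightarrow> bool" where
  "down j \<longleftrightarrow> (if j = n then \<not> descends_at n \<xi> n else descends_at n \<xi> j)"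

text \<open>A local extremum of \<xi> at j + 1 reverses the next step of \<xi>. For j = n - 1 both
  sides look at the same step, and the flip comes from the negation in \<open>down\<close>.\<close>

lemma down_Suc:
  assumes "1 \<le> j" "j < n"
  shows "down (Suc j) \<longleftrightarrow> (if turn j then \<not> down j else down j)"
proof (cases "Suc j = n")
  case True
  then have "turn j" using turn_last by (metis diff_Suc_1)
  then show ?thesis using True assms by (auto simp: down_def descends_at_def)
next
  case False
  then have eqs: "down j \<longleftrightarrow> \<xi> j = \<xi> (Suc j) + 1" "down (Suc j) \<longleftrightarrow> \<xi> (Suc j) = \<xi> (Suc (Suc j)) + 1"
    "turn j \<longleftrightarrow> \<xi> j = \<xi> (Suc (Suc j))"
    using assms turn_iff_height[of j] by (simp_all add: down_def descends_at_def)
  have "1 \<le> Suc j" "Suc j < n" using assms False by auto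
  with assms show ?thesis
    unfolding eqs using height_step[of j] height_step[of "Suc j"] by presburger
qed

text \<open>The in- and out-neighbours of \<open>j\<close> in \<open>Q\<^sub>\<xi>\<close> if \<open>down j\<close>; otherwise the roles are swapped.\<close>

definition nbr_in :: "nat \<Rightarrow> vertex set" where
  "nbr_in j = {Frz j} \<union> (if turn j then {} else {Mut (Suc j)})"

definition nbr_out :: "nat \<Rightarrow> vertex set" where
  "nbr_out j = (if 2 \<le> j then {Mut (j - 1)} else {})
     \<union> (if turn j then (if j < n then {Mut (Suc j)} else {}) else {Frz (Suc j)})"

lemma arrows_iff: "(a, b) \<in> arrows n \<xi> \<longleftrightarrow>
  (\<exists>m\<in>{1..n}. (a, b) \<in> (if descends_at n \<xi> m then edges_at n \<xi> m else (edges_at n \<xi> m)\<inverse>))"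
  by (auto simp: arrows_def simp del: if_split_asm)

lemma edge_at_iff:
  assumes "1 \<le> m" "m \<le> n"
  shows "(a, b) \<in> (if descends_at n \<xi> m then edges_at n \<xi> m else (edges_at n \<xi> m)\<inverse>) \<longleftrightarrow>
     (if down m then a \<in> nbr_in m \<and> b = Mut m \<or> a = Mut m \<and> b \<in> nbr_out m
      else a = Mut m \<and> b \<in> nbr_in m \<or> a \<in> nbr_out m \<and> b = Mut m)"
  using assms n_ge_2 turn_last(1)
  by (auto simp: down_def edges_at_def eq_diamond_iff nbr_in_def nbr_out_def simp del: turn_last split: if_splits)

lemma Q_height_at:
  assumes "1 \<le> j" "j \<le> n"
  shows "Q_height n \<xi> a (Mut j) = of_bool (a \<in> (if down j then nbr_in j else nbr_out j))" (is ?A)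
    and "Q_height n \<xi> (Mut j) a = of_bool (a \<in> (if down j then nbr_out j else nbr_in j))" (is ?B)
proof -
  \<comment> \<open>An edge between j and a neighbour is listed at both ends. By
    \<open>down_Suc\<close> the two listings agree in direction, so the listing at j alone
    determines the arrows at j.\<close>
  have shift: "(Mut j \<in> nbr_in m \<longrightarrow> (if down m = down j then Mut m \<in> nbr_out j else Mut m \<in> nbr_in j)) \<and>
      (Mut j \<in> nbr_out m \<longrightarrow> (if down m = down j then Mut m \<in> nbr_in j else Mut m \<in> nbr_out j))"
    if "m \<in> {1..n}" for m
  proof (cases "m = Suc j \<or> j = Suc m")
    case True
    then show ?thesis
      using that assms down_Suc[of j] down_Suc[of m] turn_last
      by (auto simp: nbr_in_def nbr_out_def simp del: turn_last split: if_splits)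
  next
    case False
    then show ?thesis using that by (auto simp: nbr_in_def nbr_out_def split: if_splits)
  qed
  have ex: "(\<exists>m\<in>{1..n}. P m) \<longleftrightarrow> b" if "P j = b" "\<And>m. m \<in> {1..n} \<Longrightarrow> P m \<Longrightarrow> b" for P b
    using assms that by (metis atLeastAtMost_iff)
  have "(a, Mut j) \<in> arrows n \<xi> \<longleftrightarrow> a \<in> (if down j then nbr_in j else nbr_out j)"
    unfolding arrows_iff
  proof (rule ex, goal_cases)
    case 1
    show ?case unfolding edge_at_iff[OF assms] using shift[of j] assms by auto
  next
    case (2 m)
    then have "1 \<le> m" "m \<le> n" by auto
    with 2 show ?case using shift[of m] edge_at_iff[of m a "Mut j"] by (auto split: if_splits)
  qed
  then show ?A by (simp add: Q_height_def)
  have "(Mut j, a) \<in> arrows n \<xi> \<longleftrightarrow> a \<in> (if down j then nbr_out j else nbr_in j)"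
    unfolding arrows_iff
  proof (rule ex, goal_cases)
    case 1
    show ?case unfolding edge_at_iff[OF assms] using shift[of j] assms by auto
  next
    case (2 m)
    then have "1 \<le> m" "m \<le> n" by auto
    with 2 show ?case using shift[of m] edge_at_iff[of m "Mut j" a] by (auto split: if_splits)
  qed
  then show ?B by (simp add: Q_height_def)
qed

section \<open>Sinks, sources and the blocks between turns\<close>

lemma sink_or_source_iff:
  assumes "1 \<le> j" "j < n"
  shows "sink_or_source n \<xi> j \<longleftrightarrow> j = 1 \<or> turn j"
proof -
  have ins: "(\<forall>k\<in>{1..n}. Mut k \<notin> nbr_in j) \<longleftrightarrow> turn j"
    using assms by (auto simp: nbr_in_def)
  have outs: "(\<forall>k\<in>{1..n}. Mut k \<notin> nbr_out j) \<longleftrightarrow> j = 1 \<and> \<not> turn j"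
  proof (cases "j = 1")
    case False
    with assms have "Mut (j - 1) \<in> nbr_out j" "j - 1 \<in> {1..n}"
      by (auto simp: nbr_out_def)
    with False show ?thesis by blast
  next
    case True
    with assms show ?thesis by (auto simp: nbr_out_def)
  qed
  have "sink_or_source n \<xi> j \<longleftrightarrow>
    (\<forall>k\<in>{1..n}. Mut k \<notin> nbr_in j) \<or> (\<forall>k\<in>{1..n}. Mut k \<notin> nbr_out j)"
    unfolding sink_or_source_def Q_height_at[OF assms(1) less_imp_le[OF assms(2)]]
    by (cases "down j") auto
  with ins outs show ?thesis by blast
qed

lemma bullet_Suc:
  assumes "1 \<le> j" "j < n"
  shows "bullet n \<xi> (Suc j) = (if j = 1 \<or> turn j then j else bullet n \<xi> j)"
proof -
  have *: "{k \<in> {1..<Suc j}. sink_or_source n \<xi> k} =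
      (if j = 1 \<or> turn j then {j} else {}) \<union> {k \<in> {1..<j}. sink_or_source n \<xi> k}"
    using assms sink_or_source_iff[of j] by (auto simp: less_Suc_eq)
  show ?thesis
  proof (cases "j = 1 \<or> turn j")
    case True
    have "Max {k \<in> {1..<Suc j}. sink_or_source n \<xi> k} = j"
      using True assms sink_or_source_iff[of j] by (intro Max_eqI) auto
    with True assms show ?thesis by (simp add: bullet_def)
  next
    case False
    with * assms show ?thesis by (simp add: bullet_def)
  qed
qed

lemma bullet_less: 
  assumes "1 \<le> j" "j \<le> n"
  shows "bullet n \<xi> j < j"
  using assms
proof (induction j rule: nat_induct_at_least)
  case base
  show ?case by (simp add: bullet_def)
next
  case (Suc j)
  then show ?case by (simp add: bullet_Suc)
qed

text \<open>The exception in \<open>bullet_from\<close> removes exactly the extra case j = 1 of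
  \<open>bullet_Suc\<close>, so that only turns start a new block.\<close>

lemma bullet_from_Suc:
  assumes "1 \<le> i" "i \<le> j" "j < n"
  shows "bullet_from n \<xi> i (Suc j) = (if turn j then j else bullet_from n \<xi> i j)"
proof -
  have "bullet n \<xi> 1 = 0" by (simp add: bullet_def)
  then show ?thesis
    using assms bullet_Suc[of j] turn_def[of 1] by (auto simp: bullet_from_def)
qed

lemma bullet_from_start_less:
  assumes "1 \<le> i" "i \<le> n"
  shows "bullet_from n \<xi> i i < i"
  using bullet_less assms by (auto simp: bullet_from_def)

text \<open>Induction along \<open>bullet_from_Suc\<close>: either j still lies in the first block,
  or the value is the last turn before j and not before i.\<close>

lemma bullet_from_cases:
  assumes "1 \<le> i" "i \<le> j" "j \<le> n"
  obtains (first) "bullet_from n \<xi> i j = bullet_from n \<xi> i i" "\<And>k. i \<le> k \<Longrightarrow> k < j \<Longrightarrow> \<not> turn k"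
  | (later) "i \<le> bullet_from n \<xi> i j" "bullet_from n \<xi> i j < j" "turn (bullet_from n \<xi> i j)"
      "\<And>k. bullet_from n \<xi> i j < k \<Longrightarrow> k < j \<Longrightarrow> \<not> turn k"
proof -
  have "(bullet_from n \<xi> i j = bullet_from n \<xi> i i \<and> (\<forall>k. i \<le> k \<and> k < j \<longrightarrow> \<not> turn k)) \<or>
    (i \<le> bullet_from n \<xi> i j \<and> bullet_from n \<xi> i j < j \<and> turn (bullet_from n \<xi> i j) \<and>
     (\<forall>k. bullet_from n \<xi> i j < k \<and> k < j \<longrightarrow> \<not> turn k))"
    using assms(2,3)
  proof (induction j rule: nat_induct_at_least)
    case base
    show ?case by auto
  next
    case (Suc j)
    then show ?case using assms(1) by (auto simp: bullet_from_Suc less_Suc_eq)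
  qed
  then show thesis using first later by blast
qed

section \<open>The exchange relations\<close>

text \<open>The exchange relation at \<open>j\<close> is \<open>x\<^sub>j x[\<alpha>\<^sub>i\<^sub>,\<^sub>j] = p * (\<dots>) + q * (\<dots>)\<close> with
  \<open>(p, q) = exchange_terms X i j\<close> the contributions of the neighbours of \<open>j\<close> other than \<open>j + 1\<close> and
  \<open>(j + 1)'\<close>.\<close>

definition exchange_quotient :: "(vertex \<Rightarrow> 'a::field) \<Rightarrow> nat \<Rightarrow> 'a \<times> 'a \<Rightarrow> 'a" where
  "exchange_quotient X j pq =
     (fst pq * (if turn j then 1 else x_ext n X (Suc j)) +
      snd pq * (if turn j then x_ext n X (Suc j) else X (Frz (Suc j)))) / x_ext n X j"

text \<open>The values up to index i only set the start. Afterwards the new cluster variable enters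
  the first term, and at a turn the old first term becomes the second one.\<close>

primrec exchange_terms :: "(vertex \<Rightarrow> 'a::field) \<Rightarrow> nat \<Rightarrow> nat \<Rightarrow> 'a \<times> 'a" where
  "exchange_terms X i 0 = (X (Frz i), x_ext n X (i - 1))"
| "exchange_terms X i (Suc j) =
     (if j < i then (X (Frz i), x_ext n X (i - 1))
      else (exchange_quotient X j (exchange_terms X i j) * (if turn j then X (Frz (Suc j)) else 1),
            if turn j then fst (exchange_terms X i j) else snd (exchange_terms X i j)))"

lemma exchange_terms_start: "exchange_terms X i i = (X (Frz i), x_ext n X (i - 1))"
  by (cases i) auto

definition next_in :: "nat \<Rightarrow> vertex set" where
  "next_in j = (if turn j then {} else {Mut (Suc j)})"

definition next_out :: "nat \<Rightarrow> vertex set" where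
  "next_out j = (if turn j then (if j < n then {Mut (Suc j)} else {}) else {Frz (Suc j)})"

lemma nbr_disjoint: "a \<in> nbr_in j \<Longrightarrow> a \<notin> nbr_out j"
  by (auto simp: nbr_in_def nbr_out_def split: if_splits)

lemma nbr_in_eq: "nbr_in j = insert (Frz j) (next_in j)"
  by (auto simp: nbr_in_def next_in_def)

lemma nbr_out_eq: "nbr_out j = (if 2 \<le> j then {Mut (j - 1)} else {}) \<union> next_out j"
  by (auto simp: nbr_out_def next_out_def)

text \<open>Invariant of the seed reached after mutating at \<open>i, \<dots>, j - 1\<close>: no arrow at an unfrozen
  vertex after \<open>j\<close> has changed. The sets \<open>I\<close> and \<open>S\<close> are the neighbours of \<open>j\<close> that are not
  neighbours through \<open>next_in\<close> or \<open>next_out\<close>.\<close>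

definition exchange_state ::
  "(vertex \<Rightarrow> 'a::field) \<Rightarrow> nat \<Rightarrow> nat \<Rightarrow> vertex set \<Rightarrow> vertex set \<Rightarrow> 'a seed \<Rightarrow> bool" where
  "exchange_state X i j I S s \<longleftrightarrow>
     I \<subseteq> Mut ` {1..<j} \<union> Frz ` {1..j} \<and> S \<subseteq> Mut ` {1..<j} \<union> Frz ` {1..j} \<and>
     exchange_terms X i j = (prod (fst s) I, prod (fst s) S) \<and>
     (\<forall>v. v \<notin> Mut ` {1..<j} \<longrightarrow> fst s v = X v) \<and>
     (\<forall>k a. j < k \<and> k \<le> n \<longrightarrow>
        snd s a (Mut k) = Q_height n \<xi> a (Mut k) \<and> snd s (Mut k) a = Q_height n \<xi> (Mut k) a) \<and>
     (\<forall>a. snd s a (Mut j) = of_bool (a \<in> (if down j then I \<union> next_in j else S \<union> next_out j)) \<and>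
          snd s (Mut j) a = of_bool (a \<in> (if down j then S \<union> next_out j else I \<union> next_in j)))"

lemma exchange_state_start:
  assumes "1 \<le> i" "i \<le> n"
  shows "exchange_state X i i {Frz i} (if 2 \<le> i then {Mut (i - 1)} else {}) (X, Q_height n \<xi>)"
  using assms
  by (auto simp: exchange_state_def exchange_terms_start Q_height_at nbr_in_eq nbr_out_eq x_ext_def)

text \<open>Each exchange monomial splits over a disjoint union: the neighbours in \<open>I\<close>
  or \<open>S\<close> give \<open>exchange_terms\<close>, those in \<open>next_in\<close> or
  \<open>next_out\<close> the remaining factor of \<open>exchange_quotient\<close>. Orientation only
  permutes the two summands.\<close>

lemma exchange_state_new_variable:
  assumes "1 \<le> j" "j \<le> n" "exchange_state X i j I S (X', Q')"
  shows "fst (mutate_seed n j (X', Q')) = X'(Mut j := exchange_quotient X j (exchange_terms X i j))"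
proof -
  have sub: "I \<subseteq> Mut ` {1..<j} \<union> Frz ` {1..j}" "S \<subseteq> Mut ` {1..<j} \<union> Frz ` {1..j}"
    and pq: "exchange_terms X i j = (prod X' I, prod X' S)"
    and X': "\<And>v. v \<notin> Mut ` {1..<j} \<Longrightarrow> X' v = X v"
    and Q': "\<And>a. Q' a (Mut j) = of_bool (a \<in> (if down j then I \<union> next_in j else S \<union> next_out j))"
      "\<And>a. Q' (Mut j) a = of_bool (a \<in> (if down j then S \<union> next_out j else I \<union> next_in j))"
    using assms(3) by (auto simp: exchange_state_def)
  have fin: "finite I" "finite S" "finite (next_in j)" "finite (next_out j)"
    using sub finite_subset[of _ "Mut ` {1..<j} \<union> Frz ` {1..j}"] by (auto simp: next_in_def next_out_def)
  \<comment> \<open>As n is a turn, the neighbours with index j + 1 are genuine vertices.\<close>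
  have "\<not> turn j \<Longrightarrow> j < n" using assms(2) turn_last(1) by (metis le_neq_implies_less)
  then have "next_in j \<subseteq> vertices n" "next_out j \<subseteq> vertices n"
    by (auto simp: next_in_def next_out_def)
  moreover have old: "Mut ` {1..<j} \<union> Frz ` {1..j} \<subseteq> vertices n" using assms(2) by auto
  ultimately have V: "I \<union> next_in j \<subseteq> vertices n" "S \<union> next_out j \<subseteq> vertices n"
    using subset_trans[OF sub(1) old] subset_trans[OF sub(2) old] by simp_all
  have next_old: "(Mut ` {1..<j} \<union> Frz ` {1..j}) \<inter> next_in j = {}"
    "(Mut ` {1..<j} \<union> Frz ` {1..j}) \<inter> next_out j = {}"
    by (auto simp: next_in_def next_out_def)
  have disj: "I \<inter> next_in j = {}" "S \<inter> next_out j = {}"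
    using Int_mono[OF sub(1) order.refl, of "next_in j"] Int_mono[OF sub(2) order.refl, of "next_out j"]
    unfolding next_old by simp_all
  have next_vals: "prod X' (next_in j) = (if turn j then 1 else x_ext n X (Suc j))"
    "prod X' (next_out j) = (if turn j then x_ext n X (Suc j) else X (Frz (Suc j)))"
    using \<open>\<not> turn j \<Longrightarrow> j < n\<close> assms(2) by (auto simp: next_in_def next_out_def x_ext_def X' image_iff)
  have "prod X' (I \<union> next_in j) = prod X' I * (if turn j then 1 else x_ext n X (Suc j))"
    "prod X' (S \<union> next_out j) = prod X' S * (if turn j then x_ext n X (Suc j) else X (Frz (Suc j)))"
    using fin disj by (simp_all add: prod.union_disjoint next_vals)
  moreover have "X' (Mut j) = x_ext n X j"
    using assms(1,2) by (auto simp: x_ext_def X' image_iff)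
  ultimately show ?thesis
    using prod_power_of_bool[OF finite_vertices V(1), of X'] prod_power_of_bool[OF finite_vertices V(2), of X']
    by (simp add: mutate_seed_def Q' exchange_quotient_def pq add.commute)
qed

text \<open>At a turn, j + 1 lies on the side of \<open>S\<close>; the paths through j attach
  \<open>I\<close> to j + 1, and the reversed arrow puts \<open>Mut j\<close> on the side of
  \<open>Frz (Suc j)\<close>. Otherwise j + 1 lies on the side of \<open>I\<close>; the paths attach
  \<open>S\<close>, and the path between j + 1 and \<open>Frz (Suc j)\<close> cancels the arrow
  already there.\<close>

lemma exchange_state_step:
  assumes "1 \<le> i" "i \<le> j" "j < n" "exchange_state X i j I S (X', Q')"
  shows "exchange_state X i (Suc j) ({Mut j} \<union> (if turn j then {Frz (Suc j)} else {}))
    (if turn j then I else S) (mutate_seed n j (X', Q'))"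
proof -
  have sub: "I \<subseteq> Mut ` {1..<j} \<union> Frz ` {1..j}" "S \<subseteq> Mut ` {1..<j} \<union> Frz ` {1..j}"
    and pq: "exchange_terms X i j = (prod X' I, prod X' S)"
    and X': "\<And>v. v \<notin> Mut ` {1..<j} \<Longrightarrow> X' v = X v"
    and Q': "\<And>a. Q' a (Mut j) = of_bool (a \<in> (if down j then I \<union> next_in j else S \<union> next_out j))"
      "\<And>a. Q' (Mut j) a = of_bool (a \<in> (if down j then S \<union> next_out j else I \<union> next_in j))"
    and Q'_later: "\<And>k a. j < k \<Longrightarrow> k \<le> n \<Longrightarrow> Q' a (Mut k) = Q_height n \<xi> a (Mut k)"
      "\<And>k a. j < k \<Longrightarrow> k \<le> n \<Longrightarrow> Q' (Mut k) a = Q_height n \<xi> (Mut k) a"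
    using assms(4) by (auto simp: exchange_state_def)
  define X'' where "X'' = X'(Mut j := exchange_quotient X j (exchange_terms X i j))"
  have seed: "mutate_seed n j (X', Q') = (X'', mutate_quiver j Q')"
    using exchange_state_new_variable[of j X i I S X' Q'] assms
    by (simp add: mutate_seed_def X''_def)
  have "prod X'' I = prod X' I" "prod X'' S = prod X' S"
    using sub by (auto intro!: prod.cong simp: X''_def)
  then have terms: "exchange_terms X i (Suc j) =
      (prod X'' ({Mut j} \<union> (if turn j then {Frz (Suc j)} else {})), prod X'' (if turn j then I else S))"
    using assms(2) by (auto simp: pq X''_def X' image_iff)
  \<comment> \<open>Vertices beyond j + 1 are not adjacent to j, so no path through j reaches them;
    \<open>nbr_disjoint\<close> excludes 2-cycles, so the truncated subtraction is harmless.\<close>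
  have later: "mutate_quiver j Q' a (Mut k) = Q_height n \<xi> a (Mut k) \<and>
      mutate_quiver j Q' (Mut k) a = Q_height n \<xi> (Mut k) a" if "Suc j < k" "k \<le> n" for a k
  proof -
    have k: "1 \<le> k" "k \<le> n" "j < k" using that by auto
    have "Q' (Mut j) (Mut k) = 0" "Q' (Mut k) (Mut j) = 0"
      using that sub by (auto simp: Q' next_in_def next_out_def)
    then show ?thesis
      using k Q'_later[of k] Q_height_at[OF k(1,2), of a] nbr_disjoint[of a k]
      by (auto simp: mutate_quiver_def)
  qed
  have mem: "Mut (Suc j) \<in> I \<union> next_in j \<longleftrightarrow> \<not> turn j" "Mut (Suc j) \<in> S \<union> next_out j \<longleftrightarrow> turn j"
    using sub assms(3) by (auto simp: next_in_def next_out_def)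
  have Suc_j: "1 \<le> Suc j" "Suc j \<le> n" "j < Suc j" using assms by auto
  have nbrs: "nbr_in (Suc j) = insert (Frz (Suc j)) (next_in (Suc j))"
    "nbr_out (Suc j) = insert (Mut j) (next_out (Suc j))"
    using assms by (auto simp: nbr_in_eq nbr_out_eq)
  have next_range: "next_in j \<subseteq> {Mut (Suc j)}" "next_out j \<subseteq> {Mut (Suc j), Frz (Suc j)}"
    "next_in (Suc j) \<subseteq> {Mut (Suc (Suc j))}" "next_out (Suc j) \<subseteq> {Mut (Suc (Suc j)), Frz (Suc (Suc j))}"
    by (auto simp: next_in_def next_out_def)
  have next_turn: "turn j \<Longrightarrow> next_in j = {}" "turn j \<Longrightarrow> next_out j = {Mut (Suc j)}"
    "\<not> turn j \<Longrightarrow> next_in j = {Mut (Suc j)}" "\<not> turn j \<Longrightarrow> next_out j = {Frz (Suc j)}"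
    using assms(3) by (auto simp: next_in_def next_out_def)
  have fresh: "Mut k \<notin> I" "Mut k \<notin> S" if "j \<le> k" for k
    using sub that by auto
  have fresh': "Frz k \<notin> I" "Frz k \<notin> S" if "j < k" for k
    using sub that by auto
  have far: "Mut j \<notin> next_in (Suc j)" "Mut j \<notin> next_out (Suc j)" "Mut (Suc j) \<notin> next_in (Suc j)"
    "Mut (Suc j) \<notin> next_out (Suc j)" "Frz (Suc j) \<notin> next_in (Suc j)" "Frz (Suc j) \<notin> next_out (Suc j)"
    by (auto simp: next_in_def next_out_def)
  have next_disjoint: "\<not> (a \<in> next_in (Suc j) \<and> a \<in> next_out (Suc j))" for a
    by (auto simp: next_in_def next_out_def)
  have at: "mutate_quiver j Q' a (Mut (Suc j)) = of_bool (a \<in> (if down (Suc j)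
        then {Mut j} \<union> (if turn j then {Frz (Suc j)} else {}) \<union> next_in (Suc j)
        else (if turn j then I else S) \<union> next_out (Suc j))) \<and>
      mutate_quiver j Q' (Mut (Suc j)) a = of_bool (a \<in> (if down (Suc j)
        then (if turn j then I else S) \<union> next_out (Suc j)
        else {Mut j} \<union> (if turn j then {Frz (Suc j)} else {}) \<union> next_in (Suc j)))" for a
  proof -
    \<comment> \<open>The first five cases cover everything that the \<open>next\<close> sets at j
      and j + 1 can contain; in the last case only membership in \<open>I\<close> and
      \<open>S\<close> counts.\<close>
    consider "a = Mut j" | "a = Mut (Suc j)" | "a = Frz (Suc j)" | "a = Mut (Suc (Suc j))"
      | "a = Frz (Suc (Suc j))"
      | "a \<notin> {Mut j, Mut (Suc j), Frz (Suc j), Mut (Suc (Suc j)), Frz (Suc (Suc j))}"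
      by blast
    then show ?thesis
    proof cases
      case 6
      then have "a \<notin> next_in j" "a \<notin> next_out j" "a \<notin> next_in (Suc j)" "a \<notin> next_out (Suc j)"
        using next_range by blast+
      with 6 show ?thesis
        using down_Suc[of j] assms(1-3) mem far
        by (auto simp: mutate_quiver_def Q' Q'_later[OF Suc_j(3,2)] Q_height_at[OF Suc_j(1,2)] nbrs)
    qed (use next_disjoint[of a] down_Suc[of j] assms(1-3) mem far in
      \<open>auto simp: mutate_quiver_def Q' Q'_later[OF Suc_j(3,2)] Q_height_at[OF Suc_j(1,2)] nbrs
        next_turn fresh fresh'\<close>)
  qed
  have X''_eq: "X'' v = X v" if "v \<notin> Mut ` {1..<Suc j}" for v
    using that assms(1,2) by (auto simp: X''_def intro!: X')
  have range: "{Mut j} \<union> (if turn j then {Frz (Suc j)} else {}) \<subseteq> Mut ` {1..<Suc j} \<union> Frz ` {1..Suc j}"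
    "(if turn j then I else S) \<subseteq> Mut ` {1..<Suc j} \<union> Frz ` {1..Suc j}"
    using sub assms(1,2) by auto
  show ?thesis
    unfolding exchange_state_def seed fst_conv snd_conv
    using terms later at X''_eq range by blast
qed

lemma x_root_eq:
  assumes "1 \<le> i" "i \<le> j" "j \<le> n"
  shows "x_root n \<xi> X i j = exchange_quotient X j (exchange_terms X i j)"
proof -
  have "\<exists>I S. exchange_state X i j I S (fold (mutate_seed n) [i..<j] (X, Q_height n \<xi>))"
    using assms(2,3)
  proof (induction j rule: nat_induct_at_least)
    case base
    then show ?case using exchange_state_start[of i X] assms(1) by auto
  next
    case (Suc j)
    then obtain I S where "exchange_state X i j I S (fold (mutate_seed n) [i..<j] (X, Q_height n \<xi>))"
      by auto
    with Suc.hyps Suc.prems assms(1) show ?case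
      using exchange_state_step by (cases "fold (mutate_seed n) [i..<j] (X, Q_height n \<xi>)") fastforce
  qed
  then obtain I S X' Q' where state: "exchange_state X i j I S (X', Q')"
    and fold: "fold (mutate_seed n) [i..<j] (X, Q_height n \<xi>) = (X', Q')"
    by (metis surj_pair)
  have "x_root n \<xi> X i j = fst (mutate_seed n j (X', Q')) (Mut j)"
    using assms by (simp add: x_root_def fold)
  then show ?thesis
    using exchange_state_new_variable[OF _ _ state] assms by simp
qed

section \<open>Denominators\<close>

context
  fixes X :: "vertex \<Rightarrow> 'a::field_char_0"
  assumes indep: "algebraically_independent (vertices n) X"
begin

lemma x_ext_nonzero: "x_ext n X k \<noteq> 0"
  using algebraically_independent_nonzero[OF indep, of "Mut k"] by (simp add: x_ext_def)

abbreviation vanishing_at :: "nat \<Rightarrow> 'a \<Rightarrow> rat \<Rightarrow> bool" where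
  "vanishing_at k \<equiv> specialises (vertices n) X (\<lambda>v. of_bool (v \<noteq> Mut k))"

lemma vanishing_x_ext:
  assumes "1 \<le> k" "k \<le> n"
  shows "vanishing_at k (x_ext n X m) (of_bool (m \<noteq> k))"
proof (cases "m \<in> {1..n}")
  case True
  then show ?thesis
    using specialises.var[of "Mut m" "vertices n" X "\<lambda>v. of_bool (v \<noteq> Mut k) :: rat"]
    by (simp add: x_ext_def)
next
  case False
  with assms show ?thesis using specialises.one by (auto simp: x_ext_def)
qed

lemma vanishing_frozen:
  assumes "1 \<le> m" "m \<le> n"
  shows "vanishing_at k (X (Frz m)) 1"
  using specialises.var[of "Frz m" "vertices n" X "\<lambda>v. of_bool (v \<noteq> Mut k) :: rat"] assms by simp

abbreviation numerator :: "nat \<Rightarrow> nat \<Rightarrow> 'a" where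
  "numerator i j \<equiv> exchange_quotient X j (exchange_terms X i j) * (\<Prod>m\<in>{i..j}. x_ext n X m)"

text \<open>The factor \<open>x_ext n X j\<close> of the product absorbs the division in
  \<open>exchange_quotient\<close>.\<close>

lemma numerator_eq:
  assumes "i \<le> j"
  shows "numerator i j =
    fst (exchange_terms X i j) * (\<Prod>m\<in>{i..<j}. x_ext n X m) * (if turn j then 1 else x_ext n X (Suc j)) +
    snd (exchange_terms X i j) * (\<Prod>m\<in>{i..<j}. x_ext n X m) *
      (if turn j then x_ext n X (Suc j) else X (Frz (Suc j)))"
proof -
  have "(\<Prod>m\<in>{i..j}. x_ext n X m) = (\<Prod>m\<in>{i..<j}. x_ext n X m) * x_ext n X j"
    using assms by (simp add: prod.last_plus mult.commute flip: atLeastLessThanSuc_atLeastAtMost)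
  then show ?thesis
    using x_ext_nonzero[of j] by (simp add: exchange_quotient_def field_simps)
qed

text \<open>At a turn the summand b survives. Otherwise b is multiplied by the value of x_{j+1},
  which is 0 for k = j + 1; then positivity comes from c, as provided by the last
  assumption.\<close>

lemma numerator_vanishing_pos:
  assumes "1 \<le> j" "i \<le> j" "j \<le> n" "1 \<le> k" "k \<le> n"
    and "vanishing_at k (fst (exchange_terms X i j) * (\<Prod>m\<in>{i..<j}. x_ext n X m)) b" "0 < b"
    and "vanishing_at k (snd (exchange_terms X i j) * (\<Prod>m\<in>{i..<j}. x_ext n X m)) c" "0 \<le> c"
    and "j \<le> k \<Longrightarrow> 0 < c"
  shows "\<exists>a>0. vanishing_at k (numerator i j) a"
proof (cases "turn j")
  case True
  have "vanishing_at k (numerator i j) (b * 1 + c * of_bool (Suc j \<noteq> k))"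
    unfolding numerator_eq[OF assms(2)] if_P[OF True]
    by (rule specialises_add[OF specialises.mult[OF assms(6) specialises.one]
          specialises.mult[OF assms(8) vanishing_x_ext[OF assms(4,5)]]])
  moreover have "0 < b * 1 + c * of_bool (Suc j \<noteq> k)"
    using assms(7,9) by (intro add_pos_nonneg) auto
  ultimately show ?thesis by blast
next
  case False
  then have "Suc j \<le> n"
    using assms(3) turn_last(1) by (metis Suc_leI le_neq_implies_less)
  then have "vanishing_at k (numerator i j) (b * of_bool (Suc j \<noteq> k) + c * 1)"
    unfolding numerator_eq[OF assms(2)] if_not_P[OF False]
    by (intro specialises_add[OF specialises.mult[OF assms(6) vanishing_x_ext[OF assms(4,5)]]
          specialises.mult[OF assms(8) vanishing_frozen]]) auto
  moreover have "0 < b * of_bool (Suc j \<noteq> k) + c * 1"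
    using assms(7,9,10) by (cases "Suc j = k") (auto intro: add_pos_nonneg)
  ultimately show ?thesis by blast
qed

text \<open>Up to a frozen factor the next first term is the current numerator, so it stays
  positive. The second one acquires the factor x_j, which is 0 for j = k; hence it is claimed to be
  positive only as long as \<open>j \<le> k\<close>.\<close>

lemma exchange_terms_vanishing:
  assumes "1 \<le> i" "i \<le> j" "j \<le> n" "1 \<le> k" "k \<le> n"
  shows "\<exists>b c. vanishing_at k (fst (exchange_terms X i j) * (\<Prod>m\<in>{i..<j}. x_ext n X m)) b \<and> 0 < b \<and>
    vanishing_at k (snd (exchange_terms X i j) * (\<Prod>m\<in>{i..<j}. x_ext n X m)) c \<and> 0 \<le> c \<and>
    (j \<le> k \<longrightarrow> 0 < c)"
  using assms(2,3)
proof (induction j rule: nat_induct_at_least)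
  case base
  have "vanishing_at k (fst (exchange_terms X i i) * 1) 1"
    "vanishing_at k (snd (exchange_terms X i i) * 1) (of_bool (i - 1 \<noteq> k))"
    using vanishing_frozen[of i k] vanishing_x_ext[of k "i - 1"] assms by (simp_all add: exchange_terms_start)
  moreover have "i \<le> k \<longrightarrow> i - 1 \<noteq> k" using assms(1) by auto
  ultimately show ?case by (intro exI[of _ 1] exI[of _ "of_bool (i - 1 \<noteq> k)"]) simp
next
  case (Suc j)
  let ?D = "\<lambda>j. \<Prod>m\<in>{i..<j}. x_ext n X m"
  from Suc obtain b c where bc: "vanishing_at k (fst (exchange_terms X i j) * ?D j) b" "0 < b"
    "vanishing_at k (snd (exchange_terms X i j) * ?D j) c" "0 \<le> c" "j \<le> k \<Longrightarrow> 0 < c"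
    by auto
  with Suc assms obtain a where a: "0 < a" "vanishing_at k (numerator i j) a"
    using numerator_vanishing_pos[of j i k b c] by auto
  have D_Suc: "?D (Suc j) = ?D j * x_ext n X j" using Suc.hyps by simp
  have "vanishing_at k (numerator i j * (if turn j then X (Frz (Suc j)) else 1)) (a * 1)"
    using a specialises.mult[OF a(2) vanishing_frozen[of "Suc j" k]] Suc.prems by simp
  then have "vanishing_at k (fst (exchange_terms X i (Suc j)) * ?D (Suc j)) a"
    using Suc.hyps by (simp add: mult_ac atLeastLessThanSuc_atLeastAtMost)
  moreover have "vanishing_at k (snd (exchange_terms X i (Suc j)) * ?D (Suc j))
      ((if turn j then b else c) * of_bool (j \<noteq> k))"
    using Suc.hyps specialises.mult[OF bc(1) vanishing_x_ext[OF assms(4,5), of j]]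
      specialises.mult[OF bc(3) vanishing_x_ext[OF assms(4,5), of j]]
    by (simp add: D_Suc mult.assoc del: prod.op_ivl_Suc)
  ultimately show ?case
    using a(1) bc by (intro exI[of _ a] exI[of _ "(if turn j then b else c) * of_bool (j \<noteq> k)"]) auto
qed

lemma x_root_denominator:
  assumes "1 \<le> i" "i \<le> j" "j \<le> n"
  shows "has_denominator n X (x_root n \<xi> X i j) (\<lambda>k. if k \<in> {i..j} then 1 else 0)"
proof -
  have pos: "\<exists>a>0. vanishing_at k (numerator i j) a" if "1 \<le> k" "k \<le> n" for k
    using exchange_terms_vanishing[OF assms that] numerator_vanishing_pos[of j i k] assms that
    by fastforce
  have "(\<Prod>k\<in>{1..n}. X (Mut k) ^ (if k \<in> {i..j} then 1 else 0)) = (\<Prod>m\<in>{i..j}. X (Mut m))"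
    using assms by (intro prod.mono_neutral_cong_right) auto
  also have "\<dots> = (\<Prod>m\<in>{i..j}. x_ext n X m)"
    using assms by (intro prod.cong) (auto simp: x_ext_def)
  finally have denom: "(\<Prod>k\<in>{1..n}. X (Mut k) ^ (if k \<in> {i..j} then 1 else 0)) = \<dots>" .
  have "(\<Prod>m\<in>{i..j}. x_ext n X m) \<noteq> 0"
    using x_ext_nonzero by simp
  then have "x_root n \<xi> X i j = numerator i j / (\<Prod>m\<in>{i..j}. x_ext n X m)"
    using assms by (simp add: x_root_eq)
  moreover have "numerator i j \<in> generated_subring (X ` vertices n)"
    \<comment> \<open>Having any specialisation already certifies membership in the subring; vertex
      1 is an arbitrary choice.\<close>
    using pos[of 1] n_ge_2 specialises_in_subring by auto
  moreover have "\<forall>k\<in>{1..n}. \<not> (\<exists>M\<in>generated_subring (X ` vertices n). numerator i j = X (Mut k) * M)"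
  proof (intro ballI notI, elim bexE)
    fix k M
    assume "k \<in> {1..n}"
      and M: "M \<in> generated_subring (X ` vertices n)" "numerator i j = X (Mut k) * M"
    then have k: "1 \<le> k" "k \<le> n" by auto
    obtain c where "vanishing_at k M c"
      using subring_specialises[OF M(1)] by blast
    \<comment> \<open>A multiple of x_k specialises to 0, against uniqueness and the positive value
      in \<open>pos\<close>.\<close>
    then have "vanishing_at k (numerator i j) 0"
      unfolding M(2) using specialises.mult[OF vanishing_x_ext[OF k, of k], of M c] k
      by (simp add: x_ext_def)
    then show False
      using pos[OF k] specialises_unique[OF indep] by force
  qed
  ultimately show ?thesis
    unfolding has_denominator_def denom by (intro bexI[of _ "numerator i j"] conjI)
qed

end

section \<open>The sets \<open>\<Gamma>\<^sub>i\<^sub>,\<^sub>j\<close> as paths of a two-state automaton\<close>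

lemma block_sum_update: "m \<le> j \<Longrightarrow> block_sum n \<xi> i m (\<epsilon>(Suc j := e)) = block_sum n \<xi> i m \<epsilon>"
  by (auto simp: block_sum_def sigma_def intro!: sum.cong)

lemma block_sum_start:
  assumes "1 \<le> i" "i \<le> n"
  shows "block_sum n \<xi> i i \<epsilon> = \<epsilon> i"
proof -
  have "max i (bullet_from n \<xi> i i + 1) = i"
    using bullet_from_start_less[OF assms] by simp
  then show ?thesis by (simp add: block_sum_def sigma_def)
qed

lemma sigma_Suc: "r \<le> Suc m \<Longrightarrow> sigma r (Suc m) \<epsilon> = sigma r m \<epsilon> + \<epsilon> (Suc m)"
  by (simp add: sigma_def)

lemma bullet_from_less:
  assumes "1 \<le> i" "i \<le> j" "j \<le> n"
  shows "bullet_from n \<xi> i j < j"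
  using bullet_from_cases[OF assms] bullet_from_start_less[of i] assms by fastforce

lemma block_sum_Suc:
  assumes "1 \<le> i" "i \<le> j" "j < n"
  shows "block_sum n \<xi> i (Suc j) \<epsilon> = (if turn j then 0 else block_sum n \<xi> i j \<epsilon>) + \<epsilon> (Suc j)"
proof (cases "turn j")
  case True
  then have "max i (bullet_from n \<xi> i (Suc j) + 1) = Suc j"
    using assms by (simp add: bullet_from_Suc)
  with True show ?thesis by (simp add: block_sum_def sigma_def)
next
  case False
  have "max i (bullet_from n \<xi> i j + 1) \<le> Suc j"
    using assms bullet_from_less[of i j] by simp
  with False assms show ?thesis by (simp add: block_sum_def bullet_from_Suc sigma_Suc)
qed

lemma block_sum_nonneg:
  assumes "\<epsilon> \<in> {i..j} \<rightarrow>\<^sub>E {0..}" "m \<le> j"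
  shows "0 \<le> block_sum n \<xi> i m \<epsilon>"
  unfolding block_sum_def sigma_def using assms by (intro sum_nonneg) (auto simp: PiE_iff)

text \<open>The truncations of the elements of \<open>\<Gamma>\<^sub>i\<^sub>,\<^sub>j\<close> with last block sum \<open>s\<close>; the conditions at the earlier
  blocks are indexed by the last vertices \<open>k\<close> of these blocks.\<close>

definition states :: "nat \<Rightarrow> nat \<Rightarrow> int \<Rightarrow> (nat \<Rightarrow> int) set" where
  "states i j s = {\<epsilon> \<in> {i..j} \<rightarrow>\<^sub>E {0..}. block_sum n \<xi> i j \<epsilon> = s \<and>
     (\<forall>k\<in>{i..<j}. turn k \<longrightarrow>
        block_sum n \<xi> i k \<epsilon> \<le> 1 \<and> 1 \<le> block_sum n \<xi> i k \<epsilon> + \<epsilon> (Suc k))}"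

lemma update_inj: "inj_on (\<lambda>\<epsilon>. \<epsilon>(Suc j := e)) ({i..j} \<rightarrow>\<^sub>E A)"
proof (rule inj_onI)
  fix \<epsilon> \<epsilon>' assume *: "\<epsilon> \<in> {i..j} \<rightarrow>\<^sub>E A" "\<epsilon>' \<in> {i..j} \<rightarrow>\<^sub>E A" "\<epsilon>(Suc j := e) = \<epsilon>'(Suc j := e)"
  \<comment> \<open>Both tuples are \<open>undefined\<close> at \<open>Suc j\<close>, so overwriting
    that entry loses no information.\<close>
  then have "\<epsilon> (Suc j) = \<epsilon>' (Suc j)" by (auto simp: PiE_iff extensional_def)
  with *(3) show "\<epsilon> = \<epsilon>'" by (metis fun_upd_triv fun_upd_upd)
qed

lemma PiE_Suc_iff:
  assumes "i \<le> Suc j"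
  shows "\<epsilon> \<in> {i..Suc j} \<rightarrow>\<^sub>E A \<longleftrightarrow> (\<exists>\<epsilon>'\<in>{i..j} \<rightarrow>\<^sub>E A. \<exists>e\<in>A. \<epsilon> = \<epsilon>'(Suc j := e))"
proof -
  have "{i..Suc j} = insert (Suc j) {i..j}" using assms by auto
  then show ?thesis by (auto simp: PiE_insert_eq)
qed

text \<open>One transition of the automaton: inside a block the entry e is added to the sum r; after
  a turn a new block starts with e, and the finished block contributes its two inequalities.\<close>

lemma update_in_states_iff:
  assumes "1 \<le> i" "i \<le> j" "j < n" "\<epsilon> \<in> {i..j} \<rightarrow>\<^sub>E {0..}" "0 \<le> e"
  shows "\<epsilon>(Suc j := e) \<in> states i (Suc j) s \<longleftrightarrow>
    (\<exists>r. \<epsilon> \<in> states i j r \<and> s = (if turn j then 0 else r) + e \<and> (turn j \<longrightarrow> r \<le> 1 \<and> 1 \<le> r + e))"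
proof -
  have "\<epsilon>(Suc j := e) \<in> {i..Suc j} \<rightarrow>\<^sub>E {0..}"
    using assms by (auto simp: PiE_Suc_iff)
  moreover have "(\<forall>k\<in>{i..<Suc j}. P k) \<longleftrightarrow> P j \<and> (\<forall>k\<in>{i..<j}. P k)" for P
    using assms(2) by (auto simp: less_Suc_eq)
  ultimately show ?thesis
    using assms by (auto simp: states_def block_sum_Suc block_sum_update)
qed

lemma states_start:
  assumes "1 \<le> i" "i \<le> n" "0 \<le> s"
  shows "states i i s = {(\<lambda>_. undefined)(i := s)}"
proof (rule set_eqI)
  fix \<epsilon>
  have "\<epsilon> \<in> states i i s \<longleftrightarrow> \<epsilon> \<in> extensional {i} \<and> \<epsilon> i = s"
    using assms by (auto simp: states_def block_sum_start PiE_iff)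
  also have "\<dots> \<longleftrightarrow> \<epsilon> = (\<lambda>_. undefined)(i := s)"
    by (auto simp: extensional_def)
  finally show "\<epsilon> \<in> states i i s \<longleftrightarrow> \<epsilon> \<in> {(\<lambda>_. undefined)(i := s)}"
    by simp
qed

lemma states_nonneg: "\<epsilon> \<in> states i j s \<Longrightarrow> 0 \<le> s"
  using block_sum_nonneg[of \<epsilon> i j j] by (auto simp: states_def)

lemma states_PiE: "\<epsilon> \<in> states i j s \<Longrightarrow> \<epsilon> \<in> {i..j} \<rightarrow>\<^sub>E {0..}"
  by (simp add: states_def)

lemma inj_on_states: "inj_on (\<lambda>\<epsilon>. \<epsilon>(Suc j := e)) (states i j s)"
  by (rule inj_on_subset[OF update_inj subsetI]) (rule states_PiE)

lemma states_Suc_iff: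
  assumes "1 \<le> i" "i \<le> j" "j < n"
  shows "\<epsilon>' \<in> states i (Suc j) s \<longleftrightarrow> (\<exists>\<epsilon> e r. \<epsilon>' = \<epsilon>(Suc j := e) \<and> \<epsilon> \<in> states i j r \<and> 0 \<le> e \<and> 0 \<le> r \<and>
     s = (if turn j then 0 else r) + e \<and> (turn j \<longrightarrow> r \<le> 1 \<and> 1 \<le> r + e))"
proof -
  have "\<epsilon>' \<in> states i (Suc j) s \<longleftrightarrow>
      (\<exists>\<epsilon> e. \<epsilon>' = \<epsilon>(Suc j := e) \<and> \<epsilon> \<in> {i..j} \<rightarrow>\<^sub>E {0..} \<and> 0 \<le> e \<and> \<epsilon>(Suc j := e) \<in> states i (Suc j) s)"
    using PiE_Suc_iff[of i j \<epsilon>' "{0..}"] assms(2) states_PiE[of \<epsilon>' i "Suc j" s] by (auto simp: Bex_def)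
  then show ?thesis
    using update_in_states_iff[OF assms] states_PiE states_nonneg by blast
qed

text \<open>Nonnegativity forces e = 0. After a turn the inequalities then leave only r = 1.\<close>

lemma states_Suc_0:
  assumes "1 \<le> i" "i \<le> j" "j < n"
  shows "states i (Suc j) 0 = (\<lambda>\<epsilon>. \<epsilon>(Suc j := 0)) ` states i j (if turn j then 1 else 0)" (is "_ = ?f ` _")
proof (intro set_eqI iffI)
  fix \<epsilon>' assume "\<epsilon>' \<in> states i (Suc j) 0"
  then obtain \<epsilon> e r where *: "\<epsilon>' = \<epsilon>(Suc j := e)" "\<epsilon> \<in> states i j r" "0 \<le> e" "0 \<le> r"
    "0 = (if turn j then 0 else r) + e" "turn j \<longrightarrow> r \<le> 1 \<and> 1 \<le> r + e"
    unfolding states_Suc_iff[OF assms] by blast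
  then have "e = 0" "r = (if turn j then 1 else 0)" by (auto split: if_splits)
  with * show "\<epsilon>' \<in> ?f ` states i j (if turn j then 1 else 0)" by auto
next
  fix \<epsilon>' assume "\<epsilon>' \<in> ?f ` states i j (if turn j then 1 else 0)"
  then obtain \<epsilon> where "\<epsilon>' = \<epsilon>(Suc j := 0)" "\<epsilon> \<in> states i j (if turn j then 1 else 0)" by blast
  then show "\<epsilon>' \<in> states i (Suc j) 0"
    unfolding states_Suc_iff[OF assms]
    by (intro exI[of _ \<epsilon>] exI[of _ 0] exI[of _ "if turn j then 1 else 0"]) auto
qed

lemma states_Suc_1:
  assumes "1 \<le> i" "i \<le> j" "j < n"
  shows "states i (Suc j) 1 = (\<lambda>\<epsilon>. \<epsilon>(Suc j := 1)) ` states i j 0 \<union>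
    (\<lambda>\<epsilon>. \<epsilon>(Suc j := (if turn j then 1 else 0))) ` states i j 1" (is "_ = ?f ` _ \<union> ?g ` _")
proof (intro set_eqI iffI)
  fix \<epsilon>' assume "\<epsilon>' \<in> states i (Suc j) 1"
  then obtain \<epsilon> e r where *: "\<epsilon>' = \<epsilon>(Suc j := e)" "\<epsilon> \<in> states i j r" "0 \<le> e" "0 \<le> r"
    "1 = (if turn j then 0 else r) + e" "turn j \<longrightarrow> r \<le> 1 \<and> 1 \<le> r + e"
    unfolding states_Suc_iff[OF assms] by blast
  then have "r = 0 \<and> e = 1 \<or> r = 1 \<and> e = (if turn j then 1 else 0)" by (auto split: if_splits)
  with * show "\<epsilon>' \<in> ?f ` states i j 0 \<union> ?g ` states i j 1" by auto
next
  fix \<epsilon>' assume "\<epsilon>' \<in> ?f ` states i j 0 \<union> ?g ` states i j 1"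
  then show "\<epsilon>' \<in> states i (Suc j) 1"
  proof
    assume "\<epsilon>' \<in> ?f ` states i j 0"
    then obtain \<epsilon> where "\<epsilon>' = \<epsilon>(Suc j := 1)" "\<epsilon> \<in> states i j 0" by blast
    then show ?thesis
      unfolding states_Suc_iff[OF assms] by (intro exI[of _ \<epsilon>] exI[of _ 1] exI[of _ 0]) auto
  next
    assume "\<epsilon>' \<in> ?g ` states i j 1"
    then obtain \<epsilon> where "\<epsilon>' = \<epsilon>(Suc j := (if turn j then 1 else 0))" "\<epsilon> \<in> states i j 1" by blast
    then show ?thesis
      unfolding states_Suc_iff[OF assms]
      by (intro exI[of _ \<epsilon>] exI[of _ "if turn j then 1 else 0"] exI[of _ 1]) auto
  qed
qed

lemma finite_states:
  assumes "1 \<le> i" "i \<le> j" "j \<le> n"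
  shows "finite (states i j 0)" "finite (states i j 1)"
proof -
  have "finite (states i j 0) \<and> finite (states i j 1)"
    using assms(2,3)
  proof (induction j rule: nat_induct_at_least)
    case base
    then show ?case using assms(1) by (simp add: states_start)
  next
    case (Suc j)
    then show ?case using assms(1) by (simp add: states_Suc_0 states_Suc_1)
  qed
  then show "finite (states i j 0)" "finite (states i j 1)" by auto
qed

text \<open>The images are disjoint because the block sum at j, unaffected by the new entry, is 0 on
  one and 1 on the other.\<close>

lemma sum_updates:
  assumes "1 \<le> i" "i \<le> j" "j \<le> n"
  shows "(\<Sum>\<epsilon> \<in> (\<lambda>\<epsilon>. \<epsilon>(Suc j := e)) ` states i j 0 \<union> (\<lambda>\<epsilon>. \<epsilon>(Suc j := e')) ` states i j 1. h \<epsilon>) =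
    (\<Sum>\<epsilon>\<in>states i j 0. h (\<epsilon>(Suc j := e))) + (\<Sum>\<epsilon>\<in>states i j 1. h (\<epsilon>(Suc j := e')))"
proof -
  have "(\<lambda>\<epsilon>. \<epsilon>(Suc j := e)) ` states i j 0 \<inter> (\<lambda>\<epsilon>. \<epsilon>(Suc j := e')) ` states i j 1 = {}"
  proof (rule ccontr)
    assume "\<not> ?thesis"
    then obtain \<epsilon> \<epsilon>' where *: "\<epsilon> \<in> states i j 0" "\<epsilon>' \<in> states i j 1" "\<epsilon>(Suc j := e) = \<epsilon>'(Suc j := e')"
      by blast
    from arg_cong[OF *(3), of "block_sum n \<xi> i j"] show False
      using *(1,2) by (simp add: block_sum_update states_def)
  qed
  then show ?thesis
    using finite_states[OF assms] inj_on_states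
    by (simp add: sum.union_disjoint sum.reindex)
qed

section \<open>Comparison of the conditions in \<open>Gam\<close> with those on blocks\<close>

lemma diamond_le:
  assumes "1 \<le> i" "i \<le> k" "k \<le> n" "turn k"
  shows "diamond n \<xi> i \<le> k"
  using turn_diamond(2)[of i k] assms by (meson le_trans linorder_not_le)

lemma block_sum_first_block:
  assumes "1 \<le> i" "i \<le> n"
  shows "block_sum n \<xi> i (diamond n \<xi> i) \<epsilon> = sigma i (diamond n \<xi> i) \<epsilon>"
proof -
  have "bullet_from n \<xi> i (diamond n \<xi> i) < i"
    using bullet_from_cases[OF assms(1) diamond_bounds[OF assms(2)]] turn_diamond(2)[OF assms]
      bullet_from_start_less[OF assms] by metis
  then have "max i (bullet_from n \<xi> i (diamond n \<xi> i) + 1) = i" by simp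
  then show ?thesis by (simp add: block_sum_def)
qed

lemma block_sum_next_block:
  assumes "1 \<le> i" "i \<le> m" "m < n" "turn m"
  shows "block_sum n \<xi> i (diamond n \<xi> (m + 1)) \<epsilon> = sigma (m + 1) (diamond n \<xi> (m + 1)) \<epsilon>"
proof -
  let ?e = "diamond n \<xi> (m + 1)"
  have e: "m + 1 \<le> ?e" "?e \<le> n" "\<And>k. m + 1 \<le> k \<Longrightarrow> k < ?e \<Longrightarrow> \<not> turn k"
    using diamond_bounds[of "m + 1"] turn_diamond(2)[of "m + 1"] assms by auto
  have "i \<le> ?e" using e assms by simp
  have "bullet_from n \<xi> i ?e = m"
  proof (cases rule: bullet_from_cases[OF assms(1) \<open>i \<le> ?e\<close> e(2)])
    case 1
    then show ?thesis using assms e(1) by auto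
  next
    case 2
    then show ?thesis using e(1,3) assms(4) by (metis Suc_eq_plus1 Suc_le_eq linorder_neqE_nat not_less_eq)
  qed
  then show ?thesis using assms by (simp add: block_sum_def max_def)
qed

text \<open>Each turn ends either the first block or the block that follows the preceding turn m;
  this reindexes block ends by the m used in \<open>Gam\<close>.\<close>

lemma turn_cases:
  assumes "1 \<le> i" "i \<le> k" "k \<le> n" "turn k"
  obtains (first) "k = diamond n \<xi> i"
  | (later) m where "i \<le> m" "m < k" "turn m" "diamond n \<xi> i \<le> m" "k = diamond n \<xi> (m + 1)"
proof (cases rule: bullet_from_cases[OF assms(1-3)])
  case 1
  then show ?thesis using first diamond_eqI[of i k] assms by auto
next
  case 2
  then show ?thesis
    using later[of "bullet_from n \<xi> i k"] diamond_eqI[of "bullet_from n \<xi> i k + 1" k] diamond_le[of i "bullet_from n \<xi> i k"] assms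
    by auto
qed

text \<open>\<open>Gam\<close> indexes a later block by the turn before it, the right-hand side by
  the turn that ends it. If the first block ends at j itself, its condition is not on the right and
  follows from the assumptions on the last block.\<close>

lemma Gam_conditions_iff:
  assumes "1 \<le> i" "i \<le> j" "j \<le> n" and \<epsilon>: "\<epsilon> \<in> {i..j + 1} \<rightarrow>\<^sub>E {0..}"
    and last: "block_sum n \<xi> i j \<epsilon> \<le> 1" "turn j \<Longrightarrow> \<epsilon> (j + 1) = 1"
  shows "(diamond n \<xi> i \<le> j \<longrightarrow>
        sigma i (diamond n \<xi> i) \<epsilon> \<le> 1 \<and> 1 \<le> sigma i (diamond n \<xi> i + 1) \<epsilon>) \<and>
     (\<forall>m. diamond n \<xi> i \<le> m \<and> m = diamond n \<xi> m \<and> m < bullet_from n \<xi> i j \<longrightarrow>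
        sigma (m + 1) (diamond n \<xi> (m + 1)) \<epsilon> \<le> 1 \<and>
        1 \<le> sigma (m + 1) (diamond n \<xi> (m + 1) + 1) \<epsilon>) \<longleftrightarrow>
    (\<forall>k\<in>{i..<j}. turn k \<longrightarrow>
        block_sum n \<xi> i k \<epsilon> \<le> 1 \<and> 1 \<le> block_sum n \<xi> i k \<epsilon> + \<epsilon> (Suc k))"
    (is "?A \<and> ?B \<longleftrightarrow> ?C")
proof
  assume AB: "?A \<and> ?B"
  show ?C
  proof (intro ballI impI)
    fix k assume k: "k \<in> {i..<j}" "turn k"
    then have k_le: "1 \<le> i" "i \<le> k" "k \<le> n" using assms by auto
    show "block_sum n \<xi> i k \<epsilon> \<le> 1 \<and> 1 \<le> block_sum n \<xi> i k \<epsilon> + \<epsilon> (Suc k)"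
    proof (cases rule: turn_cases[OF k_le k(2)])
      case 1
      then show ?thesis
        using AB k block_sum_first_block[of i \<epsilon>] assms by (auto simp: sigma_Suc)
    next
      case (2 m)
      \<comment> \<open>Since k is a turn before j, it cannot exceed the last such turn; thus m
        qualifies in the second condition of \<open>Gam\<close>.\<close>
      have "k \<le> bullet_from n \<xi> i j"
        using bullet_from_cases[OF assms(1-3)] k by (metis atLeastLessThan_iff linorder_not_le)
      with 2 AB have "sigma (m + 1) k \<epsilon> \<le> 1 \<and> 1 \<le> sigma (m + 1) (k + 1) \<epsilon>"
        by (auto simp: eq_diamond_iff)
      then show ?thesis
        using 2 k_le block_sum_next_block[of i m \<epsilon>] by (auto simp: sigma_Suc)
    qed
  qed
next
  assume C: ?C
  have ?A
  proof
    assume le: "diamond n \<xi> i \<le> j"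
    have d: "i \<le> diamond n \<xi> i" "turn (diamond n \<xi> i)" "i \<le> Suc (diamond n \<xi> i)"
      using diamond_bounds[of i] turn_diamond(1)[of i] assms by auto
    show "sigma i (diamond n \<xi> i) \<epsilon> \<le> 1 \<and> 1 \<le> sigma i (diamond n \<xi> i + 1) \<epsilon>"
    proof (cases "diamond n \<xi> i = j")
      case True
      have "0 \<le> block_sum n \<xi> i j \<epsilon>" using \<epsilon> by (intro block_sum_nonneg) auto
      then show ?thesis
        using last block_sum_first_block[of i \<epsilon>] assms d True by (simp add: sigma_Suc)
    next
      case False
      with le d C have "block_sum n \<xi> i (diamond n \<xi> i) \<epsilon> \<le> 1 \<and>
          1 \<le> block_sum n \<xi> i (diamond n \<xi> i) \<epsilon> + \<epsilon> (Suc (diamond n \<xi> i))" by auto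
      then show ?thesis
        using block_sum_first_block[of i \<epsilon>] assms d by (simp add: sigma_Suc)
    qed
  qed
  moreover have ?B
  proof (intro allI impI)
    fix m assume m: "diamond n \<xi> i \<le> m \<and> m = diamond n \<xi> m \<and> m < bullet_from n \<xi> i j"
    then have "turn m" "i \<le> m"
      using diamond_bounds(1)[of i] assms by (auto simp: eq_diamond_iff)
    let ?e = "diamond n \<xi> (m + 1)"
    have "i \<le> bullet_from n \<xi> i j" using m \<open>i \<le> m\<close> by simp
    then have "bullet_from n \<xi> i j < j \<and> turn (bullet_from n \<xi> i j)"
      using bullet_from_start_less[of i] assms(1-3)
      by (cases rule: bullet_from_cases[OF assms(1-3)]) simp_all
    then have b: "bullet_from n \<xi> i j < j" "turn (bullet_from n \<xi> i j)" by simp_all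
    have e: "?e < j" "m + 1 \<le> ?e" "turn ?e" "m < n"
      using diamond_le[of "m + 1" "bullet_from n \<xi> i j"] diamond_bounds[of "m + 1"]
        turn_diamond(1)[of "m + 1"] b m assms by auto
    then have "block_sum n \<xi> i ?e \<epsilon> \<le> 1 \<and> 1 \<le> block_sum n \<xi> i ?e \<epsilon> + \<epsilon> (Suc ?e)"
      using C \<open>i \<le> m\<close> by auto
    then show "sigma (m + 1) ?e \<epsilon> \<le> 1 \<and> 1 \<le> sigma (m + 1) (?e + 1) \<epsilon>"
      using block_sum_next_block[OF assms(1) \<open>i \<le> m\<close> e(4) \<open>turn m\<close>, of \<epsilon>] e by (simp add: sigma_Suc)
  qed
  ultimately show "?A \<and> ?B" ..
qed

text \<open>The last entry \<open>1 + (dd n \<xi> j - 1) * s\<close> is 1 for s = 0 and d_j for s =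
  1, so the state at j determines it. These are the same updates as in
  \<open>states_Suc_1\<close>.\<close>

lemma Gam_eq:
  assumes "1 \<le> i" "i \<le> j" "j \<le> n"
  shows "Gam n \<xi> i j = (\<lambda>\<epsilon>. \<epsilon>(Suc j := 1)) ` states i j 0 \<union>
    (\<lambda>\<epsilon>. \<epsilon>(Suc j := (if turn j then 1 else 0))) ` states i j 1"
proof -
  have iff: "\<epsilon>(Suc j := e) \<in> Gam n \<xi> i j \<longleftrightarrow>
      \<epsilon> \<in> states i j 0 \<and> e = 1 \<or> \<epsilon> \<in> states i j 1 \<and> e = (if turn j then 1 else 0)"
    if \<epsilon>: "\<epsilon> \<in> {i..j} \<rightarrow>\<^sub>E {0..}" "0 \<le> e" for \<epsilon> e
  proof -
    let ?s = "block_sum n \<xi> i j \<epsilon>"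
    have PiE: "\<epsilon>(Suc j := e) \<in> {i..j + 1} \<rightarrow>\<^sub>E {0..}"
      using assms \<epsilon> by (auto simp: PiE_Suc_iff)
    have last: "block_sum n \<xi> i j (\<epsilon>(Suc j := e)) = ?s"
      by (simp add: block_sum_update)
    have C: "(\<forall>k\<in>{i..<j}. turn k \<longrightarrow> block_sum n \<xi> i k (\<epsilon>(Suc j := e)) \<le> 1 \<and>
        1 \<le> block_sum n \<xi> i k (\<epsilon>(Suc j := e)) + (\<epsilon>(Suc j := e)) (Suc k)) \<longleftrightarrow> \<epsilon> \<in> states i j ?s"
      using \<epsilon> by (auto simp: states_def block_sum_update)
    have "\<epsilon>(Suc j := e) \<in> Gam n \<xi> i j \<longleftrightarrow>
        e = 1 + (dd n \<xi> j - 1) * ?s \<and> ?s \<le> 1 \<and> \<epsilon> \<in> states i j ?s"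
      using Gam_conditions_iff[OF assms PiE, unfolded C last] PiE
      unfolding Gam_def mem_Collect_eq last by (auto simp: dd_eq)
    moreover have "0 \<le> ?s" using \<epsilon> by (intro block_sum_nonneg) auto
    then have "?s \<le> 1 \<longleftrightarrow> ?s = 0 \<or> ?s = 1" by auto
    moreover have "\<epsilon> \<in> states i j 0 \<Longrightarrow> ?s = 0" "\<epsilon> \<in> states i j 1 \<Longrightarrow> ?s = 1"
      by (simp_all add: states_def)
    ultimately show ?thesis by (auto simp: dd_eq)
  qed
  show ?thesis
  proof (intro set_eqI iffI)
    fix \<epsilon>' assume G: "\<epsilon>' \<in> Gam n \<xi> i j"
    then have "\<epsilon>' \<in> {i..Suc j} \<rightarrow>\<^sub>E {0..}" by (simp add: Gam_def)
    then obtain \<epsilon> e where "\<epsilon> \<in> {i..j} \<rightarrow>\<^sub>E {0..}" "0 \<le> e" "\<epsilon>' = \<epsilon>(Suc j := e)"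
      using assms(2) by (auto simp: PiE_Suc_iff)
    with G iff show "\<epsilon>' \<in> (\<lambda>\<epsilon>. \<epsilon>(Suc j := 1)) ` states i j 0 \<union>
      (\<lambda>\<epsilon>. \<epsilon>(Suc j := (if turn j then 1 else 0))) ` states i j 1" by blast
  next
    fix \<epsilon>' assume "\<epsilon>' \<in> (\<lambda>\<epsilon>. \<epsilon>(Suc j := 1)) ` states i j 0 \<union>
      (\<lambda>\<epsilon>. \<epsilon>(Suc j := (if turn j then 1 else 0))) ` states i j 1"
    then show "\<epsilon>' \<in> Gam n \<xi> i j"
      using iff states_PiE by auto
  qed
qed

section \<open>The expansion formula\<close>

text \<open>The condition under which \<open>p_map\<close> uses its first case.\<close>

definition saturated :: "nat \<Rightarrow> nat \<Rightarrow> (nat \<Rightarrow> int) \<Rightarrow> bool" where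
  "saturated i j \<epsilon> \<longleftrightarrow>
     bullet_from n \<xi> i i = bullet_from n \<xi> i j \<or> block_sum n \<xi> i (bullet_from n \<xi> i j) \<epsilon> = 1"

text \<open>If the preceding block has sum 0, its lower inequality makes the first entry of the
  current block at least 1, so s is not 0. Hence the last case of \<open>p_map\<close> never occurs
  in state 0.\<close>

lemma states_saturated:
  assumes "1 \<le> i" "i \<le> j" "j \<le> n" "\<epsilon> \<in> states i j s"
  shows "\<not> saturated i j \<epsilon> \<Longrightarrow> i \<le> bullet_from n \<xi> i j \<and> block_sum n \<xi> i (bullet_from n \<xi> i j) \<epsilon> = 0"
    and "s = 0 \<Longrightarrow> saturated i j \<epsilon>"
proof -
  let ?b = "bullet_from n \<xi> i j"
  have "saturated i j \<epsilon> \<or> i \<le> ?b \<and> block_sum n \<xi> i ?b \<epsilon> = 0 \<and> s \<noteq> 0"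
  proof (cases rule: bullet_from_cases[OF assms(1-3)])
    case 1
    then show ?thesis by (simp add: saturated_def)
  next
    case 2
    let ?r = "block_sum n \<xi> i ?b \<epsilon>"
    have r: "?r \<le> 1" "1 \<le> ?r + \<epsilon> (Suc ?b)"
      using 2 assms(4) by (auto simp: states_def)
    have "0 \<le> ?r"
      using 2 assms(4) states_PiE by (intro block_sum_nonneg[of _ i j]) auto
    then consider "?r = 1" | "?r = 0" using r(1) by linarith
    then show ?thesis
    proof cases
      case r0: 2
      have "s = sigma (Suc ?b) j \<epsilon>"
        using 2(1) assms(4) by (simp add: states_def block_sum_def)
      moreover have "\<epsilon> (Suc ?b) \<le> sigma (Suc ?b) j \<epsilon>"
        unfolding sigma_def using 2 states_PiE[OF assms(4)]
        by (intro member_le_sum) (auto simp: PiE_iff)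
      ultimately show ?thesis using r r0 2(1) by auto
    qed (simp add: saturated_def)
  qed
  then show "\<not> saturated i j \<epsilon> \<Longrightarrow> i \<le> ?b \<and> block_sum n \<xi> i ?b \<epsilon> = 0" "s = 0 \<Longrightarrow> saturated i j \<epsilon>"
    by auto
qed

lemma saturated_Suc:
  assumes "1 \<le> i" "i \<le> j" "j < n"
  shows "saturated i (Suc j) (\<epsilon>(Suc j := e)) \<longleftrightarrow>
    (if turn j then block_sum n \<xi> i j \<epsilon> = 1 else saturated i j \<epsilon>)"
  using assms bullet_from_start_less[of i] bullet_from_less[of i j]
  by (auto simp: saturated_def bullet_from_Suc block_sum_update)

lemma p_map_restrict: "m \<le> j \<Longrightarrow> p_map n \<xi> i j \<epsilon> m = p_map n \<xi> i m \<epsilon> m"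
  by (simp add: p_map_def)

text \<open>The exponent at m involves entries up to m + 1 only; it is final once that entry has
  been appended.\<close>

lemma p_map_update_below:
  assumes "1 \<le> i" "i \<le> m" "m < j" "j \<le> n"
  shows "p_map n \<xi> i m (\<epsilon>(Suc j := e)) m = p_map n \<xi> i m \<epsilon> m"
  using assms bullet_from_less[of i m] by (simp add: p_map_def Let_def block_sum_update)

lemma p_map_update:
  assumes "1 \<le> i" "i \<le> j" "j \<le> n" "\<epsilon> \<in> states i j s" "s = 0 \<or> s = 1"
  shows "p_map n \<xi> i j (\<epsilon>(Suc j := e)) j =
    (if \<not> saturated i j \<epsilon> then (if turn j then 1 - e else 0)
     else if s = 0 then (if turn j then - 1 else - e)
     else (if turn j then 1 - (\<epsilon> j + e) else - (\<epsilon> j + e)))"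
  using assms states_saturated[OF assms(1-4)] bullet_from_less[OF assms(1-3)]
  by (auto simp: p_map_def Let_def dd_eq saturated_def block_sum_update states_def)

text \<open>\<open>weight X i j\<close> is the part of \<open>f_mono * m_mono\<close> that is determined by the entries up to \<open>j\<close>; the
  exponent \<open>excess i j \<epsilon>\<close> of \<open>x\<^sub>j\<close> is normalised such that the recursion for the weights becomes
  the exchange relation.\<close>

definition excess :: "nat \<Rightarrow> nat \<Rightarrow> (nat \<Rightarrow> int) \<Rightarrow> int" where
  "excess i j \<epsilon> =
     (if block_sum n \<xi> i j \<epsilon> = 0 then 0 else if saturated i j \<epsilon> then 1 - \<epsilon> j else 1)"

definition weight :: "(vertex \<Rightarrow> 'a::field) \<Rightarrow> nat \<Rightarrow> nat \<Rightarrow> (nat \<Rightarrow> int) \<Rightarrow> 'a" where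
  "weight X i j \<epsilon> =
     x_ext n X (i - 1) powi (1 - \<epsilon> i) * (\<Prod>m\<in>{i..<j}. x_ext n X m powi p_map n \<xi> i m \<epsilon> m) *
     x_ext n X j powi excess i j \<epsilon> * (\<Prod>m\<in>{i..j}. X (Frz m) powi \<epsilon> m)"

text \<open>For the updates that lead to state 1 or to \<open>Gam\<close>, the drop by 1 is the
  division by x_j in the exchange relation.\<close>

lemma p_map_excess:
  assumes "1 \<le> i" "i \<le> j" "j \<le> n" "\<epsilon> \<in> states i j s" "s = 0 \<or> s = 1"
    and "e = (if s = 0 \<or> turn j then 1 else 0)"
  shows "p_map n \<xi> i j (\<epsilon>(Suc j := e)) j = excess i j \<epsilon> - 1"
  using p_map_update[OF assms(1-5), of e] states_saturated(2)[OF assms(1-4)] assms(4-6)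
  by (auto simp: excess_def states_def)

text \<open>Updates leading to state 0 correspond to the inherited term, which is not divided by
  x_j.\<close>

lemma p_map_excess_0:
  assumes "1 \<le> i" "i \<le> j" "j \<le> n" "\<epsilon> \<in> states i j (if turn j then 1 else 0)"
  shows "p_map n \<xi> i j (\<epsilon>(Suc j := 0)) j = excess i j \<epsilon>"
  using p_map_update[OF assms(1-4), of 0] states_saturated(2)[OF assms(1-4)] assms(4)
  by (auto simp: excess_def states_def)

text \<open>The values are the exponents of x_{j+1} in the matching factors of
  \<open>exchange_quotient\<close>, and 0 for the inherited term.\<close>

lemma excess_Suc:
  assumes "1 \<le> i" "i \<le> j" "j < n" "\<epsilon> \<in> states i j s"
  shows "s = (if turn j then 1 else 0) \<Longrightarrow> excess i (Suc j) (\<epsilon>(Suc j := 0)) = 0"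
    and "s = 0 \<Longrightarrow> excess i (Suc j) (\<epsilon>(Suc j := 1)) = (if turn j then 1 else 0)"
    and "s = 1 \<Longrightarrow> excess i (Suc j) (\<epsilon>(Suc j := (if turn j then 1 else 0))) = (if turn j then 0 else 1)"
  using assms states_saturated(2)[OF assms(1,2) less_imp_le[OF assms(3)] assms(4)]
  by (auto simp: excess_def saturated_Suc block_sum_Suc block_sum_update states_def)

context
  fixes X :: "vertex \<Rightarrow> 'a::field_char_0"
  assumes indep: "algebraically_independent (vertices n) X"
begin

lemma prod_below_update:
  assumes "1 \<le> i" "i \<le> j" "j \<le> n"
  shows "(\<Prod>m\<in>{i..j}. x_ext n X m powi p_map n \<xi> i m (\<epsilon>(Suc j := e)) m) =
    (\<Prod>m\<in>{i..<j}. x_ext n X m powi p_map n \<xi> i m \<epsilon> m) * x_ext n X j powi p_map n \<xi> i j (\<epsilon>(Suc j := e)) j"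
proof -
  have "{i..j} = insert j {i..<j}" using assms by auto
  then have "(\<Prod>m\<in>{i..j}. x_ext n X m powi p_map n \<xi> i m (\<epsilon>(Suc j := e)) m) =
      (\<Prod>m\<in>{i..<j}. x_ext n X m powi p_map n \<xi> i m (\<epsilon>(Suc j := e)) m) *
      x_ext n X j powi p_map n \<xi> i j (\<epsilon>(Suc j := e)) j" by simp
  also have "(\<Prod>m\<in>{i..<j}. x_ext n X m powi p_map n \<xi> i m (\<epsilon>(Suc j := e)) m) =
      (\<Prod>m\<in>{i..<j}. x_ext n X m powi p_map n \<xi> i m \<epsilon> m)"
    using assms by (intro prod.cong) (auto simp: p_map_update_below)
  finally show ?thesis .
qed

lemma frozen_update:
  "(\<Prod>m\<in>{i..j}. X (Frz m) powi (\<epsilon>(Suc j := e)) m) = (\<Prod>m\<in>{i..j}. X (Frz m) powi \<epsilon> m)"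
  by (intro prod.cong) auto

text \<open>Appending an entry replaces the provisional exponent
  \<open>excess i j \<epsilon>\<close> of x_j by the final one, whence the difference of
  exponents.\<close>

lemma weight_update:
  assumes "1 \<le> i" "i \<le> j" "j < n"
  shows "weight X i (Suc j) (\<epsilon>(Suc j := e)) = weight X i j \<epsilon> *
    x_ext n X j powi (p_map n \<xi> i j (\<epsilon>(Suc j := e)) j - excess i j \<epsilon>) * X (Frz (Suc j)) powi e *
    x_ext n X (Suc j) powi excess i (Suc j) (\<epsilon>(Suc j := e))"
proof -
  have "{i..Suc j} = insert (Suc j) {i..j}" using assms by auto
  then have "(\<Prod>m\<in>{i..Suc j}. X (Frz m) powi (\<epsilon>(Suc j := e)) m) =
      (\<Prod>m\<in>{i..j}. X (Frz m) powi \<epsilon> m) * X (Frz (Suc j)) powi e"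
    by (simp add: frozen_update del: fun_upd_apply) simp
  moreover have "x_ext n X j powi p_map n \<xi> i j (\<epsilon>(Suc j := e)) j =
      x_ext n X j powi excess i j \<epsilon> * x_ext n X j powi (p_map n \<xi> i j (\<epsilon>(Suc j := e)) j - excess i j \<epsilon>)"
    using x_ext_nonzero[OF indep, of j] by (simp flip: power_int_add)
  moreover have "(\<epsilon>(Suc j := e)) i = \<epsilon> i" using assms by simp
  ultimately show ?thesis
    using prod_below_update[of i j \<epsilon> e] assms
    unfolding weight_def atLeastLessThanSuc_atLeastAtMost by (simp add: mult_ac)
qed

lemma monomial_update:
  assumes "1 \<le> i" "i \<le> j" "j \<le> n" "\<epsilon> \<in> states i j s" "s = 0 \<or> s = 1"
    and e: "e = (if s = 0 \<or> turn j then 1 else 0)"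
  shows "f_mono n \<xi> X i j (\<epsilon>(Suc j := e)) * m_mono n \<xi> X i j (\<epsilon>(Suc j := e)) =
    weight X i j \<epsilon> / x_ext n X j *
    (if s = 0 then (if turn j then x_ext n X (Suc j) else X (Frz (Suc j)))
     else (if turn j then 1 else x_ext n X (Suc j)))"
proof -
  let ?\<epsilon> = "\<epsilon>(Suc j := e)"
  have "{i..j + 1} = insert (Suc j) {i..j}" using assms by auto
  then have "(\<Prod>m=i..j + 1. x_ext n X m powi p_map n \<xi> i j ?\<epsilon> m) =
      (\<Prod>m\<in>{i..j}. x_ext n X m powi p_map n \<xi> i j ?\<epsilon> m) * x_ext n X (Suc j) powi p_map n \<xi> i j ?\<epsilon> (Suc j)"
    by simp
  also have "(\<Prod>m\<in>{i..j}. x_ext n X m powi p_map n \<xi> i j ?\<epsilon> m) =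
      (\<Prod>m\<in>{i..j}. x_ext n X m powi p_map n \<xi> i m ?\<epsilon> m)"
    by (intro prod.cong refl arg_cong[of _ _ "(powi) _"] p_map_restrict) simp
  also have "(\<Prod>m\<in>{i..j}. x_ext n X m powi p_map n \<xi> i m ?\<epsilon> m) =
      (\<Prod>m\<in>{i..<j}. x_ext n X m powi p_map n \<xi> i m \<epsilon> m) * (x_ext n X j powi excess i j \<epsilon> / x_ext n X j)"
    using prod_below_update[of i j \<epsilon> e] p_map_excess[OF assms] assms(1-3) x_ext_nonzero[OF indep, of j]
    by (simp add: power_int_diff)
  also have "p_map n \<xi> i j ?\<epsilon> (Suc j) = (if turn j then 1 - s else s)"
    using assms(4) by (simp add: p_map_def dd_eq block_sum_update states_def)
  finally have m: "(\<Prod>m=i..j + 1. x_ext n X m powi p_map n \<xi> i j ?\<epsilon> m) =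
      (\<Prod>m\<in>{i..<j}. x_ext n X m powi p_map n \<xi> i m \<epsilon> m) * (x_ext n X j powi excess i j \<epsilon> / x_ext n X j) *
      x_ext n X (Suc j) powi (if turn j then 1 - s else s)" .
  have i: "?\<epsilon> i = \<epsilon> i" using assms by simp
  \<comment> \<open>By the choice of e, the exponent (1 - d_j) e is 1 exactly when s = 0 and j is no
    turn.\<close>
  have f: "f_mono n \<xi> X i j ?\<epsilon> = (\<Prod>m\<in>{i..j}. X (Frz m) powi \<epsilon> m) *
      (if s = 0 \<and> \<not> turn j then X (Frz (Suc j)) else 1)"
    unfolding f_mono_def frozen_update using e by (simp add: dd_eq)
  show ?thesis
    unfolding m_mono_def m f i weight_def using assms(5) by (auto simp: mult_ac)
qed

lemma sum_updates_eq_quotient: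
  assumes "1 \<le> i" "i \<le> j" "j \<le> n"
    and terms: "exchange_terms X i j = (\<Sum>\<epsilon>\<in>states i j 1. weight X i j \<epsilon>, \<Sum>\<epsilon>\<in>states i j 0. weight X i j \<epsilon>)"
  shows "exchange_quotient X j (exchange_terms X i j) =
    (\<Sum>\<epsilon>\<in>states i j 0. weight X i j \<epsilon> / x_ext n X j * (if turn j then x_ext n X (Suc j) else X (Frz (Suc j)))) +
    (\<Sum>\<epsilon>\<in>states i j 1. weight X i j \<epsilon> / x_ext n X j * (if turn j then 1 else x_ext n X (Suc j)))"
  by (simp add: exchange_quotient_def terms add_divide_distrib add.commute
      flip: sum_distrib_right sum_divide_distrib)

lemma exchange_terms_eq:
  assumes "1 \<le> i" "i \<le> j" "j \<le> n"
  shows "exchange_terms X i j = (\<Sum>\<epsilon>\<in>states i j 1. weight X i j \<epsilon>, \<Sum>\<epsilon>\<in>states i j 0. weight X i j \<epsilon>)"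
  using assms(2,3)
proof (induction j rule: nat_induct_at_least)
  case base
  then show ?case
    using assms(1)
    by (simp add: exchange_terms_start states_start weight_def excess_def block_sum_start saturated_def)
next
  case (Suc j)
  then have ij: "1 \<le> i" "i \<le> j" "j < n" "j \<le> n" using assms(1) by auto
  have x0: "x_ext n X j \<noteq> 0" by (rule x_ext_nonzero[OF indep])
  \<comment> \<open>After a turn the appended entry is 1 from either state, giving this common
    factor; otherwise \<open>Frz (Suc j)\<close> occurs only from state 0 and is already part of the
    quotient.\<close>
  let ?f = "if turn j then X (Frz (Suc j)) else 1"
  have up0: "weight X i (Suc j) (\<epsilon>(Suc j := 0)) = weight X i j \<epsilon>"
    if "\<epsilon> \<in> states i j (if turn j then 1 else 0)" for \<epsilon>
    using weight_update[OF ij(1-3), of \<epsilon> 0] p_map_excess_0[OF ij(1,2,4) that]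
      excess_Suc(1)[OF ij(1-3) that] by simp
  have up1: "weight X i (Suc j) (\<epsilon>(Suc j := 1)) =
      weight X i j \<epsilon> / x_ext n X j * (if turn j then x_ext n X (Suc j) else X (Frz (Suc j))) * ?f"
    if "\<epsilon> \<in> states i j 0" for \<epsilon>
    using weight_update[OF ij(1-3), of \<epsilon> 1] p_map_excess[OF ij(1,2,4) that, of 1]
      excess_Suc(2)[OF ij(1-3) that] by (simp add: power_int_minus divide_inverse)
  have up2: "weight X i (Suc j) (\<epsilon>(Suc j := (if turn j then 1 else 0))) =
      weight X i j \<epsilon> / x_ext n X j * (if turn j then 1 else x_ext n X (Suc j)) * ?f"
    if "\<epsilon> \<in> states i j 1" for \<epsilon>
    using weight_update[OF ij(1-3), of \<epsilon> "if turn j then 1 else 0"] p_map_excess[OF ij(1,2,4) that]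
      excess_Suc(3)[OF ij(1-3) that] by (simp add: power_int_minus divide_inverse)
  have terms: "exchange_terms X i j =
      (\<Sum>\<epsilon>\<in>states i j 1. weight X i j \<epsilon>, \<Sum>\<epsilon>\<in>states i j 0. weight X i j \<epsilon>)"
    using Suc by simp
  have "(\<Sum>\<epsilon>\<in>states i (Suc j) 1. weight X i (Suc j) \<epsilon>) = exchange_quotient X j (exchange_terms X i j) * ?f"
    unfolding states_Suc_1[OF ij(1-3)] sum_updates[OF ij(1,2,4)] sum_updates_eq_quotient[OF ij(1,2,4) terms]
      distrib_right sum_distrib_right
    using up1 up2 by (intro arg_cong2[of _ _ _ _ "(+)"] sum.cong) auto
  moreover have "(\<Sum>\<epsilon>\<in>states i (Suc j) 0. weight X i (Suc j) \<epsilon>) =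
      (\<Sum>\<epsilon>\<in>states i j (if turn j then 1 else 0). weight X i j \<epsilon>)"
    unfolding states_Suc_0[OF ij(1-3)] using up0 by (simp add: sum.reindex inj_on_states)
  ultimately show ?case
    using ij by (simp add: terms)
qed

lemma x_root_expansion:
  assumes "1 \<le> i" "i \<le> j" "j \<le> n"
  shows "x_root n \<xi> X i j = (\<Sum>\<epsilon>\<in>Gam n \<xi> i j. f_mono n \<xi> X i j \<epsilon> * m_mono n \<xi> X i j \<epsilon>)"
  unfolding x_root_eq[OF assms] Gam_eq[OF assms] sum_updates[OF assms]
    sum_updates_eq_quotient[OF assms exchange_terms_eq[OF assms]]
  by (intro arg_cong2[of _ _ _ _ "(+)"] sum.cong refl) (simp_all add: monomial_update[OF assms])

end

end

theorem proposition2p5: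
  fixes n i j :: nat and \<xi> :: "nat \<Rightarrow> int" and X :: "vertex \<Rightarrow> 'a::field_char_0"
  assumes "n \<ge> 2"
    and "height_function n \<xi>"
    and "algebraically_independent (vertices n) X"
    and "1 \<le> i" and "i \<le> j" and "j \<le> n"
  shows "has_denominator n X (x_root n \<xi> X i j) (\<lambda>k. if k \<in> {i..j} then 1 else 0)
    \<and> x_root n \<xi> X i j = (\<Sum>\<epsilon>\<in>Gam n \<xi> i j. f_mono n \<xi> X i j \<epsilon> * m_mono n \<xi> X i j \<epsilon>)"
proof -
  interpret height_quiver n \<xi> using assms(1,2) by unfold_locales
  show ?thesis
    using x_root_denominator[OF assms(3-6)] x_root_expansion[OF assms(3-6)] by blast
qed

end
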